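(* Let $\{p_{\boldsymbol\theta}\}$ be a $d$-parameter statistical model with parameter space $\Theta\subset\mathbb{R}^d$, satisfying (A1)--(A2) and (R1)--(R5) (listed in the context). For fixed $0<\delta\le 1$ and $d<\infty$, let $M=M(\epsilon)$ be the minimal number of repetitions required to guarantee that the maximum-likelihood estimator satisfies $$\Pr\big[\|\tilde{\boldsymbol\theta}^{\mathrm{ML}}-\boldsymbol\theta\|_2\le\epsilon\big]\ge 1-\delta\quad\text{for all }\boldsymbol\theta\in\Theta ,$$ i.e. the minimal number $M_0$ such that this guarantee holds for all numbers of repetitions $\ge M_0$. Then, in the small-error limit $\epsilon\to0$, $$M\lesssim d\,W_0(8\pi^{-1}\delta^{-2}d^2)\,\sup_{\boldsymbol\theta\in\Theta}\max_{a\in[d]}[\mathbf F_{\boldsymbol\theta}^{-1}]_{aa}\,\epsilon^{-2} .$$ Equivalently, the minimal sample complexity $N_{\mathrm{samp}}=N_{\mathcal E}M$ is upper bounded as $$N_{\mathrm{samp}}\lesssim N_{\mathcal E}\,d\,W_0(8\pi^{-1}\delta^{-2}d^2)\,\sup_{\boldsymbol\theta\in\Theta}\max_{a\in[d]}[\mathbf F_{\boldsymbol\theta}^{-1}]_{aa}\,\epsilon^{-2} .$$ Here $A_\epsilon\lesssim B_\epsilon$ means $\limsup_{\epsilon\to0}A_\epsilon/B_\epsilon\le1$ with $\delta$ and $d$ fixed.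
   Context: Setting. $p_{\boldsymbol\theta}(x)$ is the probability of outcome $x$ in one run of a fixed quantum estimation protocol, $p_{\boldsymbol\theta}(x)=\mathrm{Tr}[\hat\Pi_x\mathcal E_{\boldsymbol\theta}(\hat\rho_0)]$, where $\hat\rho_0$ is a fixed state, $\mathcal E_{\boldsymbol\theta}$ a parametrized quantum channel that uses an elementary parameter-dependent channel a fixed number $N_{\mathcal E}$ of times, and $\{\hat\Pi_x\}_x$ a POVM. The protocol is repeated independently $M$ times, giving i.i.d. outcomes $\boldsymbol x=(x_1,\dots,x_M)$ with law $\prod_i p_{\boldsymbol\theta}(x_i)$, $\boldsymbol\theta$ being the true parameter; $\Pr$ and $\mathbb E_{\boldsymbol\theta}$ refer to this law, and $X$ denotes a single outcome. The sample complexity is $N_{\mathrm{samp}}=MN_{\mathcal E}$. Notation. $[d]=\{1,\dots,d\}$. $\ell_{\boldsymbol\theta}(x)=\log p_{\boldsymbol\theta}(x)$, with gradient $\ell^{(1)}_{\boldsymbol\theta}(x)\in\mathbb R^d$, Hessian $\ell^{(2)}_{\boldsymbol\theta}(x)\in\mathbb R^{d\times d}$ and third-derivative tensor $\ell^{(3)}_{\boldsymbol\theta}(x)\in\mathbb R^{d\times d\times d}$ with respect to $\boldsymbol\theta$; $\ell_{\boldsymbol\theta}(\boldsymbol x)=\sum_{i=1}^M\ell_{\boldsymbol\theta}(x_i)$. The Fisher information matrix is $\mathbf F_{\boldsymbol\theta}=\mathbb E_{\boldsymbol\theta}[\ell^{(1)}_{\boldsymbol\theta}(X)\ell^{(1)}_{\boldsymbol\theta}(X)^{\mathsf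 T}]$, with $\mathbb E_{\boldsymbol\theta}[\ell^{(1)}_{\boldsymbol\theta}(X)]=0$ and $\mathbb E_{\boldsymbol\theta}[\ell^{(2)}_{\boldsymbol\theta}(X)]=-\mathbf F_{\boldsymbol\theta}$. $\tilde{\boldsymbol\theta}^{\mathrm{ML}}=\tilde{\boldsymbol\theta}^{\mathrm{ML}}(\boldsymbol x)$ is the maximizer of $\boldsymbol\theta\mapsto\ell_{\boldsymbol\theta}(\boldsymbol x)$ over $\Theta$. $\|\cdot\|_2$ on vectors is the Euclidean norm. $\|\cdot\|_{\mathrm{op}}$ is the Euclidean operator norm for matrices, and for a third-order tensor $\mathbf T$ it is $\sup|\sum_{ijk}T_{ijk}u_iv_jw_k|$ over Euclidean unit vectors $u,v,w$. $W_0$ is the principal branch of the Lambert $W$ function. Assumptions. (A1) Unique maximizer and stationary point: $\ell_{\boldsymbol\theta}(\boldsymbol x)$ has a unique maximizer $\tilde{\boldsymbol\theta}^{\mathrm{ML}}$ in the interior of the parameter domain $\Theta$, which is also the unique stationary point. (A2) Smoothness: $\ell_{\boldsymbol\theta}(\boldsymbol x)$ is three times continuously differentiable with respect to $\boldsymbol\theta$ on the parameter domain $\Theta$. (R1) Let $\widetilde\Theta$ be an open ambient parameter domain containing $\Theta$. There exists $r_0>0$ such that $\boldsymbol\theta+\boldsymbol\Delta\in\widetilde\Theta$ for all $\boldsymbol\theta\in\Theta$ and $\|\boldsymbol\Delta\|_2\le r_0$. (R2) $\mathbf F_{\boldsymbol\theta}$ is non-singular for every $\boldsymbol\theta\in\Theta$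 and $\sup_{\boldsymbol\theta\in\Theta}\|\mathbf F_{\boldsymbol\theta}^{-1}\|_{\mathrm{op}}<\infty$. (R3) $\sup_{\boldsymbol\theta\in\Theta}\mathbb E_{\boldsymbol\theta}[\mathrm{Tr}\{(\ell^{(2)}_{\boldsymbol\theta}(X)+\mathbf F_{\boldsymbol\theta})^2\}]<\infty$. (R4) $\sup_{\boldsymbol\theta\in\Theta}\mathbb E_{\boldsymbol\theta}[(\sup_{\|\boldsymbol\Delta\|_2\le r_0}\|\ell^{(3)}_{\boldsymbol\theta+\boldsymbol\Delta}(X)\|_{\mathrm{op}})^2]<\infty$. (R5) $\sup_{\boldsymbol\theta\in\Theta}\sup_{\|\boldsymbol u\|_2=1}\dfrac{\mathbb E_{\boldsymbol\theta}[|\boldsymbol u^{\mathsf T}\mathbf F_{\boldsymbol\theta}^{-1}\ell^{(1)}_{\boldsymbol\theta}(X)|^3]}{(\boldsymbol u^{\mathsf T}\mathbf F_{\boldsymbol\theta}^{-1}\boldsymbol u)^{3/2}}<\infty$.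
   Formalization: In (A1) the stationary point is required to be unique in the whole open ambient domain containing Θ, where (A2) is also assumed; with uniqueness only inside Θ the claim fails, e.g. for a lattice-Gaussian family whose parameter line is cut at a point and pulled apart. *)

theory Defs
  imports "HOL-Probability.Probability"
begin

definition partial_deriv :: "'n \<Rightarrow> (real^'n \<Rightarrow> real) \<Rightarrow> real^'n \<Rightarrow> real" where
  "partial_deriv i f t = frechet_derivative f (at t) (axis i 1)"

definition gradient :: "(real^'n \<Rightarrow> real) \<Rightarrow> real^'n \<Rightarrow> real^'n" where
  "gradient f t = (\<chi> i. partial_deriv i f t)"

definition hessian :: "(real^'n \<Rightarrow> real) \<Rightarrow> real^'n \<Rightarrow> real^'n^'n" where
  "hessian f t = (\<chi> i j. partial_deriv i (partial_deriv j f) t)"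

definition third_deriv :: "(real^'n \<Rightarrow> real) \<Rightarrow> real^'n \<Rightarrow> real^'n^'n^'n" where
  "third_deriv f t = (\<chi> i j k. partial_deriv i (partial_deriv j (partial_deriv k f)) t)"

text \<open>\<open>k\<close>-fold continuous differentiability; meant for open sets \<open>S\<close> only.\<close>

primrec Ck_on :: "nat \<Rightarrow> (real^'n \<Rightarrow> real) \<Rightarrow> (real^'n) set \<Rightarrow> bool" where
  "Ck_on 0 f S \<longleftrightarrow> continuous_on S f"
| "Ck_on (Suc k) f S \<longleftrightarrow>
     (\<forall>t\<in>S. f differentiable (at t)) \<and> (\<forall>i. Ck_on k (partial_deriv i f) S)"

definition outer_self :: "real^'n \<Rightarrow> real^'n^'n" where
  "outer_self v = (\<chi> i j. v $ i * v $ j)"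

definition op_norm :: "real^'n^'n \<Rightarrow> real" where
  "op_norm A = onorm (\<lambda>v. A *v v)"

definition tensor_op_norm :: "real^'n^'n^'n \<Rightarrow> real" where
  "tensor_op_norm T =
     Sup {\<bar>\<Sum>i\<in>UNIV. \<Sum>j\<in>UNIV. \<Sum>k\<in>UNIV. T $ i $ j $ k * u $ i * v $ j * w $ k\<bar> | u v w.
          norm u = 1 \<and> norm v = 1 \<and> norm w = 1}"

text \<open>The principal real branch of the Lambert \<open>W\<close> function, meaningful for \<open>x \<ge> - exp (- 1)\<close>.\<close>

definition Lambert_W0 :: "real \<Rightarrow> real" where
  "Lambert_W0 x = (THE w. - 1 \<le> w \<and> w * exp w = x)"

text \<open>
  A model is a family \<open>p\<close> of probability mass functions indexed by the parameter vector.
  The data of \<open>M\<close> independent repetitions are lists of length \<open>M\<close>, with law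
  \<open>replicate_pmf M (p t)\<close>. Since \<open>ln 0 = 0\<close>, the log-likelihood is meaningful only at outcomes of
  positive probability.
\<close>

definition log_lik :: "(real^'n \<Rightarrow> 'x pmf) \<Rightarrow> 'x \<Rightarrow> real^'n \<Rightarrow> real" where
  "log_lik p x t = ln (pmf (p t) x)"

definition data_log_lik :: "(real^'n \<Rightarrow> 'x pmf) \<Rightarrow> 'x list \<Rightarrow> real^'n \<Rightarrow> real" where
  "data_log_lik p xs t = (\<Sum>x\<leftarrow>xs. log_lik p x t)"

definition fisher :: "(real^'n \<Rightarrow> 'x pmf) \<Rightarrow> real^'n \<Rightarrow> real^'n^'n" where
  "fisher p t = measure_pmf.expectation (p t) (\<lambda>x. outer_self (gradient (log_lik p x) t))"

definition mle :: "(real^'n \<Rightarrow> 'x pmf) \<Rightarrow> (real^'n) set \<Rightarrow> 'x list \<Rightarrow> real^'n" where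
  "mle p \<Theta> xs = arg_max_on (data_log_lik p xs) \<Theta>"

definition mle_guarantee ::
  "(real^'n \<Rightarrow> 'x pmf) \<Rightarrow> (real^'n) set \<Rightarrow> real \<Rightarrow> real \<Rightarrow> nat \<Rightarrow> bool" where
  "mle_guarantee p \<Theta> \<delta> \<epsilon> M \<longleftrightarrow>
     (\<forall>t\<in>\<Theta>. measure_pmf.prob (replicate_pmf M (p t)) {xs. norm (mle p \<Theta> xs - t) \<le> \<epsilon>} \<ge> 1 - \<delta>)"

text \<open>
  The value is \<open>\<infinity>\<close> if no threshold exists, so that upper bounds on it also assert existence.
\<close>

definition min_repetitions ::
  "(real^'n \<Rightarrow> 'x pmf) \<Rightarrow> (real^'n) set \<Rightarrow> real \<Rightarrow> real \<Rightarrow> enat" where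
  "min_repetitions p \<Theta> \<delta> \<epsilon> =
     (INF M0 \<in> {M0. 1 \<le> M0 \<and> (\<forall>M\<ge>M0. mle_guarantee p \<Theta> \<delta> \<epsilon> M)}. enat M0)"

definition min_samples ::
  "nat \<Rightarrow> (real^'n \<Rightarrow> 'x pmf) \<Rightarrow> (real^'n) set \<Rightarrow> real \<Rightarrow> real \<Rightarrow> enat" where
  "min_samples N p \<Theta> \<delta> \<epsilon> = enat N * min_repetitions p \<Theta> \<delta> \<epsilon>"

definition asymp_le :: "(real \<Rightarrow> enat) \<Rightarrow> (real \<Rightarrow> real) \<Rightarrow> bool" where
  "asymp_le A B \<longleftrightarrow> Limsup (at_right 0) (\<lambda>\<epsilon>. ereal_of_enat (A \<epsilon>) / ereal (B \<epsilon>)) \<le> 1"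

end

theory Submission
  imports Defs
begin

text \<open>
  Multiplying the averaged score at \<open>t + \<Delta>\<close> by \<open>F\<^sup>-\<^sup>1\<close> and adding \<open>\<Delta>\<close> gives a self-map of the ball of radius
  \<open>\<epsilon>\<close>, as soon as \<open>F\<^sup>-\<^sup>1\<close> times the averaged score at \<open>t\<close> has norm at most \<open>(1 - \<eta>) \<epsilon>\<close>, the averaged Hessian
  is close to \<open>- F\<close>, and the averaged third derivatives are bounded. Its fixed point (Brouwer) is a
  stationary point within \<open>\<epsilon>\<close> of \<open>t\<close>, hence the maximum-likelihood estimate; no separate consistency
  argument is needed. The last two conditions fail with small probability by Chebyshev and Markov,
  uniformly in \<open>t\<close>. The first one is a Gaussian tail event per coordinate, by a central limit theorem
  that is uniform over laws with bounded third moment, and the Lambert function is what solves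
  \<open>exp (- c\<^sup>2 / 2) / c = const\<close> for the threshold \<open>c = sqrt W\<close>.
\<close>

section \<open>Partial derivatives and Taylor expansion\<close>

text \<open>A fraction \<open>\<eta>\<close> of the radius is kept back for the nonlinear part of
  the score. It stays fixed while \<open>\<epsilon>\<close> tends to 0, and only the limit superior
  lets it become small, so a limit theorem without a rate suffices. The two error sources scale
  differently. The Hessian deviation is multiplied by \<open>\<epsilon>\<close>, so it has to be a
  small constant, which many repetitions ensure. The third derivatives are multiplied by
  \<open>\<epsilon>\<^sup>2\<close>, so a bound that holds with high probability is enough, however
  large; small \<open>\<epsilon>\<close> does the rest. One number of repetitions must serve every
  \<open>t\<close> in \<open>\<Theta>\<close>. Hence each threshold may depend on the model only
  through the suprema in R2 to R5, and pointwise convergence in \<open>t\<close> would not do. Near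
  the boundary of \<open>\<Theta>\<close> the fixed point may leave \<open>\<Theta>\<close>. The
  construction therefore lives in \<open>\<Theta>'\<close>, where A1 makes the stationary point
  unique.\<close>

lemma frechet_derivative_gradient:
  fixes f :: "real^'n \<Rightarrow> real"
  assumes "f differentiable (at t)"
  shows "frechet_derivative f (at t) v = gradient f t \<bullet> v"
proof -
  interpret D: linear "frechet_derivative f (at t)"
    using assms by (rule linear_frechet_derivative)
  have "frechet_derivative f (at t) v = frechet_derivative f (at t) (\<Sum>i\<in>UNIV. v $ i *\<^sub>R axis i 1)"
    using basis_expansion[of v] by (simp add: scalar_mult_eq_scaleR)
  also have "\<dots> = gradient f t \<bullet> v"
    by (simp add: D.sum D.scaleR gradient_def partial_deriv_def inner_vec_def mult.commute)
  finally show ?thesis .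
qed

lemma has_real_derivative_along_line:
  fixes f :: "real^'n \<Rightarrow> real"
  assumes "f differentiable (at (a + s *\<^sub>R v))"
  shows "((\<lambda>s. f (a + s *\<^sub>R v)) has_real_derivative gradient f (a + s *\<^sub>R v) \<bullet> v) (at s)"
proof -
  have "(f has_derivative frechet_derivative f (at (a + s *\<^sub>R v))) (at (a + s *\<^sub>R v))"
    using assms by (simp add: frechet_derivative_works)
  moreover have "((\<lambda>s. a + s *\<^sub>R v) has_derivative (\<lambda>h. h *\<^sub>R v)) (at s)"
    by (auto intro!: derivative_eq_intros)
  ultimately have "((\<lambda>s. f (a + s *\<^sub>R v)) has_derivative
      (\<lambda>h. frechet_derivative f (at (a + s *\<^sub>R v)) (h *\<^sub>R v))) (at s)"
    using has_derivative_compose by blast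
  then show ?thesis
    by (simp add: has_field_derivative_def frechet_derivative_gradient[OF assms] mult_commute_abs)
qed

text \<open>The mean value theorem is applied once per direction. The left-hand side of the equation
  is symmetric in \<open>i\<close> and \<open>j\<close> while the right-hand side is not, which is
  what forces second derivatives to commute.\<close>

lemma mixed_difference_mean_value:
  fixes f :: "real^'n \<Rightarrow> real"
  assumes h: "0 < h"
    and f: "\<And>x y. 0 \<le> x \<Longrightarrow> x \<le> h \<Longrightarrow> 0 \<le> y \<Longrightarrow> y \<le> h \<Longrightarrow>
      f differentiable (at (t + x *\<^sub>R axis i 1 + y *\<^sub>R axis j 1))"
    and g: "\<And>x y. 0 \<le> x \<Longrightarrow> x \<le> h \<Longrightarrow> 0 \<le> y \<Longrightarrow> y \<le> h \<Longrightarrow>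
      partial_deriv i f differentiable (at (t + x *\<^sub>R axis i 1 + y *\<^sub>R axis j 1))"
  obtains x y where "0 \<le> x" "x \<le> h" "0 \<le> y" "y \<le> h"
    "f (t + h *\<^sub>R axis i 1 + h *\<^sub>R axis j 1) - f (t + h *\<^sub>R axis i 1) - f (t + h *\<^sub>R axis j 1) + f t
      = h\<^sup>2 * partial_deriv j (partial_deriv i f) (t + x *\<^sub>R axis i 1 + y *\<^sub>R axis j 1)"
proof -
  let ?a = "axis i 1 :: real^'n" and ?b = "axis j 1 :: real^'n"
  have swap: "t + h *\<^sub>R ?b + s *\<^sub>R ?a = t + s *\<^sub>R ?a + h *\<^sub>R ?b" for s
    by (simp only: add_ac)
  define \<phi> where "\<phi> s = f (t + h *\<^sub>R ?b + s *\<^sub>R ?a) - f (t + s *\<^sub>R ?a)" for s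
  have d\<phi>: "(\<phi> has_real_derivative
      partial_deriv i f (t + h *\<^sub>R ?b + s *\<^sub>R ?a) - partial_deriv i f (t + s *\<^sub>R ?a)) (at s)"
    if "0 \<le> s" "s \<le> h" for s
  proof -
    have "f differentiable (at (t + h *\<^sub>R ?b + s *\<^sub>R ?a))"
      unfolding swap using that h by (intro f) auto
    moreover have "f differentiable (at (t + s *\<^sub>R ?a))"
      using f[of s 0] that h by simp
    ultimately show ?thesis
      unfolding \<phi>_def
      using has_real_derivative_along_line[of f "t + h *\<^sub>R ?b" s ?a]
        has_real_derivative_along_line[of f t s ?a]
      by (intro DERIV_diff) (simp_all only: gradient_def inner_axis vec_lambda_beta inner_real_def mult_1_right)
  qed
  obtain x where x: "0 < x" "x < h" "\<phi> h - \<phi> 0 = (h - 0) *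
      (partial_deriv i f (t + h *\<^sub>R ?b + x *\<^sub>R ?a) - partial_deriv i f (t + x *\<^sub>R ?a))"
    using MVT2[OF h d\<phi>] by blast
  let ?\<psi> = "\<lambda>s. partial_deriv i f (t + x *\<^sub>R ?a + s *\<^sub>R ?b)"
  have d\<psi>: "(?\<psi> has_real_derivative
      partial_deriv j (partial_deriv i f) (t + x *\<^sub>R ?a + s *\<^sub>R ?b)) (at s)"
    if "0 \<le> s" "s \<le> h" for s
  proof -
    have "partial_deriv i f differentiable (at (t + x *\<^sub>R ?a + s *\<^sub>R ?b))"
      using that x by (intro g) auto
    from has_real_derivative_along_line[OF this] show ?thesis
      by (simp only: gradient_def inner_axis vec_lambda_beta inner_real_def mult_1_right)
  qed
  obtain y where y: "0 < y" "y < h" "?\<psi> h - ?\<psi> 0 = (h - 0) *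
      partial_deriv j (partial_deriv i f) (t + x *\<^sub>R ?a + y *\<^sub>R ?b)"
    using MVT2[OF h d\<psi>] by blast
  show thesis
  proof (rule that[of x y])
    have "\<phi> h - \<phi> 0 = h * (?\<psi> h - ?\<psi> 0)"
      using x(3) unfolding swap by simp
    also have "\<dots> = h\<^sup>2 * partial_deriv j (partial_deriv i f) (t + x *\<^sub>R ?a + y *\<^sub>R ?b)"
      unfolding y(3) by (simp add: power2_eq_square)
    finally show "f (t + h *\<^sub>R ?a + h *\<^sub>R ?b) - f (t + h *\<^sub>R ?a) - f (t + h *\<^sub>R ?b) + f t
      = h\<^sup>2 * partial_deriv j (partial_deriv i f) (t + x *\<^sub>R ?a + y *\<^sub>R ?b)"
      unfolding \<phi>_def swap by simp
  qed (use x y in auto)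
qed

text \<open>Schwarz's theorem: both mixed partials are limits of the same second difference
  quotient, by their continuity at \<open>t\<close>. The symmetry serves twice: to read
  \<open>trace (A ** A)\<close> as a sum of squares, and to match the index order of
  \<open>hessian\<close> in the Taylor expansion.\<close>

lemma partial_deriv_commute:
  fixes f :: "real^'n \<Rightarrow> real"
  assumes C: "Ck_on 2 f S" and S: "open S" and t: "t \<in> S"
  shows "partial_deriv i (partial_deriv j f) t = partial_deriv j (partial_deriv i f) t"
proof -
  have C1: "f differentiable (at s)" "partial_deriv k f differentiable (at s)"
    and C2: "continuous_on S (partial_deriv k (partial_deriv l f))"
    if "s \<in> S" for s k l
    using C that by (auto simp: numeral_2_eq_2)
  let ?f = "\<lambda>k l. partial_deriv k (partial_deriv l f)"
  obtain r where r: "0 < r" "cball t r \<subseteq> S"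
    using S t open_contains_cball by blast
  \<comment> \<open>Halving \<open>r\<close> leaves room for two coordinate steps of length at most
    \<open>h n\<close> inside the ball of radius \<open>r\<close>.\<close>
  define h where "h n = r / 2 / real (Suc n)" for n
  have h: "0 < h n" "h n \<le> r / 2" for n
    using r by (auto simp: h_def divide_le_eq mult_le_cancel_left1)
  have h_lim: "h \<longlonglongrightarrow> 0"
    unfolding h_def by (rule LIMSEQ_Suc[OF lim_const_over_n])
  have inS: "t + x *\<^sub>R axis k 1 + y *\<^sub>R axis l 1 \<in> S"
    and dist_le: "dist t (t + x *\<^sub>R axis k 1 + y *\<^sub>R axis l 1) \<le> 2 * h n"
    if "0 \<le> x" "x \<le> h n" "0 \<le> y" "y \<le> h n" for x y k l n
  proof -
    have *: "norm (x *\<^sub>R axis k 1 + y *\<^sub>R axis l 1 :: real^'n) \<le> 2 * h n"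
      by (rule order_trans[OF norm_triangle_ineq]) (use that in \<open>simp add: norm_axis_1\<close>)
    have "dist t (t + x *\<^sub>R axis k 1 + y *\<^sub>R axis l 1) = norm (x *\<^sub>R axis k 1 + y *\<^sub>R axis l 1 :: real^'n)"
      unfolding dist_commute[of t] by (simp only: dist_norm add.assoc add_diff_cancel_left')
    with * show d: "dist t (t + x *\<^sub>R axis k 1 + y *\<^sub>R axis l 1) \<le> 2 * h n"
      by simp
    show "t + x *\<^sub>R axis k 1 + y *\<^sub>R axis l 1 \<in> S"
      using d h(2)[of n] r by (intro subsetD[OF r(2)]) simp
  qed
  \<comment> \<open>With each mixed partial written as \<open>lim\<close> of an explicit sequence,
    symmetry reduces to the equality of two sequences.\<close>
  have lim: "?f l k t = lim (\<lambda>n. (f (t + h n *\<^sub>R axis k 1 + h n *\<^sub>R axis l 1) - f (t + h n *\<^sub>R axis k 1)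
      - f (t + h n *\<^sub>R axis l 1) + f t) / (h n)\<^sup>2)" (is "_ = lim ?q") for k l
  proof -
    have "\<exists>z. dist t z \<le> 2 * h n \<and> z \<in> S \<and> ?q n = ?f l k z" for n
    proof -
      obtain x y where *: "0 \<le> x" "x \<le> h n" "0 \<le> y" "y \<le> h n"
        "f (t + h n *\<^sub>R axis k 1 + h n *\<^sub>R axis l 1) - f (t + h n *\<^sub>R axis k 1) - f (t + h n *\<^sub>R axis l 1) + f t
        = (h n)\<^sup>2 * ?f l k (t + x *\<^sub>R axis k 1 + y *\<^sub>R axis l 1)"
        by (rule mixed_difference_mean_value[of "h n" f t k l, OF h(1) C1(1)[OF inS[of _ n]] C1(2)[OF inS[of _ n]]])
      have "?q n = ?f l k (t + x *\<^sub>R axis k 1 + y *\<^sub>R axis l 1)"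
        unfolding *(5) using h(1)[of n] by simp
      with dist_le[OF *(1-4)] inS[OF *(1-4)] show ?thesis
        by blast
    qed
    then obtain z where z: "\<And>n. dist t (z n) \<le> 2 * h n" "\<And>n. z n \<in> S" "\<And>n. ?q n = ?f l k (z n)"
      by metis
    have "(\<lambda>n. 2 * h n) \<longlonglongrightarrow> 0"
      using tendsto_mult_right_zero[OF h_lim] by simp
    then have "(\<lambda>n. dist (z n) t) \<longlonglongrightarrow> 0"
      by (rule Lim_null_comparison[rotated]) (use z(1) in \<open>simp add: dist_commute\<close>)
    then have "z \<longlonglongrightarrow> t"
      by (rule tendsto_dist_iff[THEN iffD2])
    then have "(\<lambda>n. ?f l k (z n)) \<longlonglongrightarrow> ?f l k t"
      by (rule continuous_on_tendsto_compose[OF C2[OF t]]) (use t z in auto)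
    then show ?thesis
      by (simp add: z(3) limI)
  qed
  let ?a = "axis i 1 :: real^'n" and ?b = "axis j 1 :: real^'n"
  have "f (t + h n *\<^sub>R ?b + h n *\<^sub>R ?a) - f (t + h n *\<^sub>R ?b) - f (t + h n *\<^sub>R ?a) + f t
      = f (t + h n *\<^sub>R ?a + h n *\<^sub>R ?b) - f (t + h n *\<^sub>R ?a) - f (t + h n *\<^sub>R ?b) + f t" for n
  proof -
    have "t + h n *\<^sub>R ?b + h n *\<^sub>R ?a = t + h n *\<^sub>R ?a + h n *\<^sub>R ?b"
      by (simp only: add_ac)
    from arg_cong[OF this, of f] show ?thesis
      by linarith
  qed
  then show ?thesis
    unfolding lim by (simp only:)
qed

lemma Ck_on_3_imp_Ck_on_2:
  assumes "Ck_on 3 f S"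
  shows "Ck_on 2 f S"
proof -
  have "f differentiable (at s)" "partial_deriv k f differentiable (at s)"
    "partial_deriv j (partial_deriv k f) differentiable (at s)"
    if "s \<in> S" for s k j
    using assms that by (auto simp: numeral_3_eq_3)
  then show ?thesis
    by (simp add: numeral_2_eq_2 continuous_at_imp_continuous_on differentiable_imp_continuous_within)
qed

section \<open>Third-order tensors and the Taylor remainder of the gradient\<close>

lemma tensor_form_le:
  fixes T :: "real^'n^'n^'n"
  shows "\<bar>\<Sum>i\<in>UNIV. \<Sum>j\<in>UNIV. \<Sum>k\<in>UNIV. T $ i $ j $ k * u $ i * v $ j * w $ k\<bar>
    \<le> tensor_op_norm T * norm u * norm v * norm w"
proof -
  let ?F = "\<lambda>u v w. \<Sum>i\<in>UNIV. \<Sum>j\<in>UNIV. \<Sum>k\<in>UNIV. T $ i $ j $ k * u $ i * v $ j * w $ k"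
  let ?S = "{\<bar>?F u v w\<bar> | u v w. norm u = 1 \<and> norm v = 1 \<and> norm w = 1}"
  \<comment> \<open>\<open>tensor_op_norm\<close> is a real \<open>Sup\<close>, which bounds the
    members of its set only once that set is known to be bounded above.\<close>
  have "bdd_above ?S"
  proof (rule bdd_aboveI)
    fix y assume "y \<in> ?S"
    then obtain u v w where y: "y = \<bar>?F u v w\<bar>" and n: "norm u = 1" "norm v = 1" "norm w = 1"
      by auto
    have c: "\<bar>u $ i\<bar> \<le> 1" "\<bar>v $ i\<bar> \<le> 1" "\<bar>w $ i\<bar> \<le> 1" for i
      using component_le_norm_cart[of u i] component_le_norm_cart[of v i]
        component_le_norm_cart[of w i] n by auto
    have "\<bar>T $ i $ j $ k * u $ i * v $ j * w $ k\<bar> \<le> \<bar>T $ i $ j $ k\<bar> * 1 * 1 * 1" for i j k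
      unfolding abs_mult by (intro mult_mono c) auto
    then show "y \<le> (\<Sum>i\<in>UNIV. \<Sum>j\<in>UNIV. \<Sum>k\<in>UNIV. \<bar>T $ i $ j $ k\<bar>)"
      unfolding y by (intro order_trans[OF sum_abs] sum_mono) simp
  qed
  then have le: "\<bar>?F u v w\<bar> \<le> tensor_op_norm T" if "norm u = 1" "norm v = 1" "norm w = 1" for u v w
    unfolding tensor_op_norm_def by (rule cSup_upper[rotated]) (use that in blast)
  show ?thesis
  proof (cases "u = 0 \<or> v = 0 \<or> w = 0")
    case False
    then have nz: "norm u > 0" "norm v > 0" "norm w > 0"
      by auto
    have "?F u v w = norm u * norm v * norm w * ?F (sgn u) (sgn v) (sgn w)"
      unfolding sgn_div_norm sum_distrib_left using nz
      by (intro sum.cong refl) (simp add: field_simps)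
    also have "\<bar>\<dots>\<bar> = norm u * norm v * norm w * \<bar>?F (sgn u) (sgn v) (sgn w)\<bar>"
      by (simp add: abs_mult)
    also have "\<dots> \<le> norm u * norm v * norm w * tensor_op_norm T"
      using False by (intro mult_left_mono le) (auto simp: norm_sgn)
    finally show ?thesis
      by (simp add: mult_ac)
  qed auto
qed

lemma tensor_op_norm_nonneg: "0 \<le> tensor_op_norm T"
proof -
  have "0 \<le> tensor_op_norm T * norm (axis undefined 1 :: real^'a) * norm (axis undefined 1 :: real^'a) * norm (axis undefined 1 :: real^'a)"
    by (rule order_trans[OF abs_ge_zero tensor_form_le])
  then show ?thesis
    by (simp add: norm_axis_1)
qed

text \<open>Pairing the remainder with a fixed vector \<open>u\<close> leaves a function of one real
  variable, to which the mean value theorem applies twice; taking \<open>u\<close> to be the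
  remainder itself then gives its norm. An integral remainder would give \<open>G / 2\<close>, but
  the constant does not affect the limit.\<close>

lemma gradient_taylor_bound:
  fixes f :: "real^'n \<Rightarrow> real"
  assumes C: "Ck_on 3 f S" and S: "open S" "cball t r \<subseteq> S" and \<Delta>: "norm \<Delta> \<le> r"
    and G: "\<And>\<Delta>. norm \<Delta> \<le> r \<Longrightarrow> tensor_op_norm (third_deriv f (t + \<Delta>)) \<le> G"
  shows "norm (gradient f (t + \<Delta>) - gradient f t - hessian f t *v \<Delta>) \<le> G * (norm \<Delta>)\<^sup>2"
proof -
  let ?R = "gradient f (t + \<Delta>) - gradient f t - hessian f t *v \<Delta>"
  have C1: "f differentiable (at s)" "partial_deriv k f differentiable (at s)"
    "partial_deriv j (partial_deriv k f) differentiable (at s)"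
    if "s \<in> S" for s k j
    using C that by (auto simp: numeral_3_eq_3)
  note C2 = Ck_on_3_imp_Ck_on_2[OF C]
  have r: "0 \<le> r"
    using \<Delta> norm_ge_zero[of \<Delta>] by linarith
  then have t: "t \<in> S"
    using S by auto
  \<comment> \<open>Differentiating component \<open>k\<close> of the gradient in direction
    \<open>j\<close> produces the partials in the order opposite to \<open>hessian\<close>.\<close>
  have sym: "hessian f t $ k $ j = partial_deriv j (partial_deriv k f) t" for k j
    using partial_deriv_commute[OF C2 S(1) t] by (simp add: hessian_def)
  have seg: "norm (s *\<^sub>R \<Delta>) \<le> norm \<Delta>" "norm (s *\<^sub>R \<Delta>) \<le> r" "t + s *\<^sub>R \<Delta> \<in> S"
    if "0 \<le> s" "s \<le> 1" for s
  proof -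
    show 1: "norm (s *\<^sub>R \<Delta>) \<le> norm \<Delta>"
      using that by (simp add: mult_left_le_one_le)
    then show 2: "norm (s *\<^sub>R \<Delta>) \<le> r"
      using \<Delta> by linarith
    then show "t + s *\<^sub>R \<Delta> \<in> S"
      using S(2) by (auto simp: dist_norm)
  qed
  have G0: "0 \<le> G"
    using order_trans[OF tensor_op_norm_nonneg G[of 0]] r by simp
  have bound: "\<bar>?R \<bullet> u\<bar> \<le> G * (norm \<Delta>)\<^sup>2 * norm u" for u
  proof -
    define h where "h s = (\<Sum>k\<in>UNIV. u $ k * partial_deriv k f (t + s *\<^sub>R \<Delta>))" for s
    define h' where "h' s = (\<Sum>k\<in>UNIV. u $ k * (\<Sum>j\<in>UNIV. \<Delta> $ j * partial_deriv j (partial_deriv k f) (t + s *\<^sub>R \<Delta>)))" for s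
    define h'' where "h'' s = (\<Sum>k\<in>UNIV. u $ k * (\<Sum>j\<in>UNIV. \<Delta> $ j *
        (\<Sum>i\<in>UNIV. \<Delta> $ i * partial_deriv i (partial_deriv j (partial_deriv k f)) (t + s *\<^sub>R \<Delta>))))" for s
    have D1: "(h has_real_derivative h' s) (at s)" if "0 \<le> s" "s \<le> 1" for s
      unfolding h_def h'_def
      by (intro DERIV_sum DERIV_cmult) (use has_real_derivative_along_line[OF C1(2)[OF seg(3)[OF that]]]
        in \<open>simp add: gradient_def inner_vec_def mult.commute\<close>)
    have D2: "(h' has_real_derivative h'' s) (at s)" if "0 \<le> s" "s \<le> 1" for s
      unfolding h'_def h''_def
      by (intro DERIV_sum DERIV_cmult) (use has_real_derivative_along_line[OF C1(3)[OF seg(3)[OF that]]]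
        in \<open>simp add: gradient_def inner_vec_def mult.commute\<close>)
    obtain x where x: "0 < x" "x < 1" "h 1 - h 0 = h' x"
      using MVT2[of 0 1 h h'] D1 by auto
    obtain y where y: "0 < y" "y < x" "h' x - h' 0 = x * h'' y"
      using MVT2[of 0 x h' h''] D2 x by auto
    have "?R \<bullet> u = h 1 - h 0 - h' 0"
      by (simp add: h_def h'_def inner_vec_def gradient_def matrix_vector_mult_def sym
          sum_subtractf sum.distrib algebra_simps)
    then have "?R \<bullet> u = x * h'' y"
      using x y by simp
    moreover have "h'' y = (\<Sum>i\<in>UNIV. \<Sum>j\<in>UNIV. \<Sum>k\<in>UNIV.
        third_deriv f (t + y *\<^sub>R \<Delta>) $ i $ j $ k * \<Delta> $ i * \<Delta> $ j * u $ k)"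
    proof -
      have "h'' y = (\<Sum>k\<in>UNIV. \<Sum>j\<in>UNIV. \<Sum>i\<in>UNIV.
        third_deriv f (t + y *\<^sub>R \<Delta>) $ i $ j $ k * \<Delta> $ i * \<Delta> $ j * u $ k)"
        unfolding h''_def sum_distrib_left third_deriv_def
        by (intro sum.cong refl) simp
      also have "\<dots> = (\<Sum>k\<in>UNIV. \<Sum>i\<in>UNIV. \<Sum>j\<in>UNIV.
        third_deriv f (t + y *\<^sub>R \<Delta>) $ i $ j $ k * \<Delta> $ i * \<Delta> $ j * u $ k)"
        by (rule sum.cong[OF refl], rule sum.swap)
      also have "\<dots> = (\<Sum>i\<in>UNIV. \<Sum>k\<in>UNIV. \<Sum>j\<in>UNIV.
        third_deriv f (t + y *\<^sub>R \<Delta>) $ i $ j $ k * \<Delta> $ i * \<Delta> $ j * u $ k)"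
        by (rule sum.swap)
      also have "\<dots> = (\<Sum>i\<in>UNIV. \<Sum>j\<in>UNIV. \<Sum>k\<in>UNIV.
        third_deriv f (t + y *\<^sub>R \<Delta>) $ i $ j $ k * \<Delta> $ i * \<Delta> $ j * u $ k)"
        by (rule sum.cong[OF refl], rule sum.swap)
      finally show ?thesis .
    qed
    moreover have "tensor_op_norm (third_deriv f (t + y *\<^sub>R \<Delta>)) * norm \<Delta> * norm \<Delta> * norm u
        \<le> G * norm \<Delta> * norm \<Delta> * norm u"
      using G[OF seg(2)[of y]] x y by (intro mult_right_mono) auto
    ultimately have "\<bar>h'' y\<bar> \<le> G * (norm \<Delta>)\<^sup>2 * norm u"
      using tensor_form_le[of "third_deriv f (t + y *\<^sub>R \<Delta>)" \<Delta> \<Delta> u]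
      by (simp add: power2_eq_square mult.assoc)
    moreover have "\<bar>x * h'' y\<bar> \<le> \<bar>h'' y\<bar>"
      using x by (simp add: abs_mult mult_left_le_one_le)
    ultimately show ?thesis
      using \<open>?R \<bullet> u = x * h'' y\<close> by linarith
  qed
  show ?thesis
  proof (cases "?R = 0")
    case True
    show ?thesis
      unfolding True using G0 by simp
  next
    case False
    have "norm ?R * norm ?R \<le> G * (norm \<Delta>)\<^sup>2 * norm ?R"
      using bound[of ?R] by (simp add: power2_norm_eq_inner[symmetric] power2_eq_square)
    then show ?thesis
      using False by simp
  qed
qed

section \<open>Sums over independent samples\<close>

lemma expectation_bind_pmf_real:
  fixes f :: "'b \<Rightarrow> real"
  assumes "\<And>x. \<bar>f x\<bar> \<le> B"
  shows "measure_pmf.expectation (bind_pmf p g) f = measure_pmf.expectation p (\<lambda>x. measure_pmf.expectation (g x) f)"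
  unfolding measure_pmf_bind
  by (rule integral_bind[where K = "count_space UNIV" and B = B and B' = 1])
    (use assms in \<open>auto intro!: measure_pmf.finite_measure_axioms measure_pmf_in_subprob_space simp: measure_pmf.emeasure_space_1[unfolded space_measure_pmf]\<close>)

lemma expectation_bind_pmf_complex:
  fixes f :: "'b \<Rightarrow> complex"
  assumes B: "\<And>x. norm (f x) \<le> B"
  shows "measure_pmf.expectation (bind_pmf p g) f = measure_pmf.expectation p (\<lambda>x. measure_pmf.expectation (g x) f)"
proof -
  have int: "integrable (measure_pmf q) f" for q
    by (rule measure_pmf.integrable_const_bound[where B = B]) (use B in auto)
  have "norm (measure_pmf.expectation q f) \<le> B" for q
  proof -
    have "norm (measure_pmf.expectation q f) \<le> measure_pmf.expectation q (\<lambda>x. norm (f x))"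
      by (rule integral_norm_bound)
    also have "\<dots> \<le> measure_pmf.expectation q (\<lambda>x. B)"
      by (rule integral_mono) (use int B in \<open>auto intro: integrable_norm\<close>)
    finally show ?thesis by simp
  qed
  then have int2: "integrable (measure_pmf p) (\<lambda>x. measure_pmf.expectation (g x) f)"
    by (intro measure_pmf.integrable_const_bound[where B = B]) auto
  have B': "\<bar>Re (f x)\<bar> \<le> B" "\<bar>Im (f x)\<bar> \<le> B" for x
    using abs_Re_le_cmod[of "f x"] abs_Im_le_cmod[of "f x"] B[of x] by linarith+
  show ?thesis
    using expectation_bind_pmf_real[of "\<lambda>x. Re (f x)", OF B'(1), of p g]
      expectation_bind_pmf_real[of "\<lambda>x. Im (f x)", OF B'(2), of p g]
    by (intro complex_eqI)
      (simp_all only: integral_Re[OF int] integral_Im[OF int] integral_Re[OF int2, symmetric] integral_Im[OF int2, symmetric])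
qed

text \<open>Independence enters the central limit theorem only here, as the factorization of the
  characteristic function of a sum.\<close>

lemma expectation_iexp_replicate_pmf:
  "measure_pmf.expectation (replicate_pmf n q) (\<lambda>xs. iexp (s * sum_list xs))
    = measure_pmf.expectation q (\<lambda>x. iexp (s * x)) ^ n"
proof (induction n)
  case (Suc n)
  have "measure_pmf.expectation (replicate_pmf (Suc n) q) (\<lambda>xs. iexp (s * sum_list xs))
    = measure_pmf.expectation q (\<lambda>x. measure_pmf.expectation (replicate_pmf n q) (\<lambda>xs. iexp (s * (x + sum_list xs))))"
    by (simp add: expectation_bind_pmf_complex[where B = 1])
  also have "\<dots> = measure_pmf.expectation q (\<lambda>x. iexp (s * x) * measure_pmf.expectation (replicate_pmf n q) (\<lambda>xs. iexp (s * sum_list xs)))"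
    by (simp add: distrib_left exp_add flip: integral_mult_right_zero)
  also have "\<dots> = measure_pmf.expectation q (\<lambda>x. iexp (s * x)) ^ Suc n"
    unfolding Suc.IH by (simp add: integral_mult_left_zero)
  finally show ?case .
qed simp

lemma integrable_if_third_moment:
  fixes q :: "real pmf"
  assumes "integrable (measure_pmf q) (\<lambda>x. \<bar>x\<bar> ^ 3)"
  shows "integrable (measure_pmf q) (\<lambda>x. x)" "integrable (measure_pmf q) (\<lambda>x. x\<^sup>2)"
proof -
  have *: "\<bar>x\<bar> ^ k \<le> 1 + \<bar>x\<bar> ^ 3" if "k \<le> 3" for x :: real and k
  proof (cases "\<bar>x\<bar> \<le> 1")
    case True
    then have "\<bar>x\<bar> ^ k \<le> 1" by (simp add: power_le_one)
    then show ?thesis by (simp add: add_increasing2)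
  next
    case False
    then have "\<bar>x\<bar> ^ k \<le> \<bar>x\<bar> ^ 3" using that by (intro power_increasing) auto
    then show ?thesis by simp
  qed
  have i: "integrable (measure_pmf q) (\<lambda>x. 1 + \<bar>x\<bar> ^ 3)"
    using assms by simp
  show "integrable (measure_pmf q) (\<lambda>x. x)"
    by (rule Bochner_Integration.integrable_bound[OF i]) (use *[of 1] in auto)
  show "integrable (measure_pmf q) (\<lambda>x. x\<^sup>2)"
    by (rule Bochner_Integration.integrable_bound[OF i]) (use *[of 2] in auto)
qed

text \<open>The law \<open>q n\<close> changes with \<open>n\<close>, so a theorem about one fixed
  law does not apply. The common bound \<open>C\<close> makes the error of the second-order
  expansion of the characteristic function uniform: each factor is off by order
  \<open>N powr (- 3 / 2)\<close>, the product of \<open>N\<close> factors by order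
  \<open>1 / sqrt N\<close>, and Levy's continuity theorem concludes.\<close>

lemma central_limit_third_moment:
  fixes q :: "nat \<Rightarrow> real pmf" and N :: "nat \<Rightarrow> nat"
  assumes N: "filterlim N at_top sequentially"
    and int: "\<And>n. integrable (measure_pmf (q n)) (\<lambda>x. \<bar>x\<bar> ^ 3)"
    and mean: "\<And>n. measure_pmf.expectation (q n) (\<lambda>x. x) = 0"
    and var: "\<And>n. measure_pmf.expectation (q n) (\<lambda>x. x\<^sup>2) = 1"
    and third: "\<And>n. measure_pmf.expectation (q n) (\<lambda>x. \<bar>x\<bar> ^ 3) \<le> C"
  shows "weak_conv_m (\<lambda>n. distr (measure_pmf (replicate_pmf (N n) (q n))) borel
      (\<lambda>xs. sum_list xs / sqrt (N n))) std_normal_distribution"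
proof (rule levy_continuity)
  fix t :: real
  define \<psi> where "\<psi> n = char (distr (measure_pmf (q n)) borel (\<lambda>x. x)) (t / sqrt (N n))" for n
  have char_eq: "char (distr (measure_pmf (replicate_pmf (N n) (q n))) borel
      (\<lambda>xs. sum_list xs / sqrt (N n))) t = \<psi> n ^ N n" for n
    using expectation_iexp_replicate_pmf[of "N n" "q n" "t / sqrt (N n)"]
    by (simp add: \<psi>_def char_def integral_distr)
  have \<psi>: "cmod (\<psi> n - (1 + (- (t\<^sup>2) / 2) / N n)) \<le> \<bar>t\<bar> ^ 3 * C / 6 / (N n * sqrt (N n))" if "N n > 0" for n
  proof -
    interpret real_distribution "distr (measure_pmf (q n)) borel (\<lambda>x. x)"
      by (rule prob_space.real_distribution_distr[OF measure_pmf.prob_space_axioms]) simp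
    let ?t = "t / sqrt (N n)"
    note int2 = integrable_if_third_moment[OF int[of n]]
    have "cmod (\<psi> n - (1 - ?t\<^sup>2 * 1 / 2)) \<le> ?t\<^sup>2 / 6 *
        measure_pmf.expectation (q n) (\<lambda>x. min (6 * x\<^sup>2) (\<bar>?t\<bar> * \<bar>x\<bar> ^ 3))"
      unfolding \<psi>_def
      by (rule prob_space.char_approx3'[OF measure_pmf.prob_space_axioms _ int2 mean]) (use var[of n] mean[of n] in auto)
    \<comment> \<open>Only the cubic branch of the minimum is kept: it is controlled by
      \<open>C\<close> and carries the extra factor \<open>1 / sqrt (N n)\<close>.\<close>
    also have "\<dots> \<le> ?t\<^sup>2 / 6 * measure_pmf.expectation (q n) (\<lambda>x. \<bar>?t\<bar> * \<bar>x\<bar> ^ 3)"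
      using int[of n] int2
      by (intro mult_left_mono integral_mono integrable_min integrable_mult_right) auto
    also have "\<dots> \<le> ?t\<^sup>2 / 6 * (\<bar>?t\<bar> * C)"
      using third[of n] by (intro mult_left_mono) (auto intro!: mult_left_mono divide_right_mono)
    also have "\<dots> = \<bar>t\<bar> ^ 3 * C / 6 / (N n * sqrt (N n))"
      using that by (simp add: power_divide power3_eq_cube power2_eq_square abs_mult field_simps)
    finally show ?thesis
      using that by (simp add: power_divide mult.commute)
  qed
  \<comment> \<open>The bound \<open>t\<^sup>2 / 4\<close> on the number of factors ensures
    \<open>1 - t\<^sup>2 / (2 * N n) \<ge> - 1\<close>. Both bases then have modulus at most 1, so
    their powers differ by at most \<open>N n\<close> times their own difference.\<close>
  have "\<forall>\<^sub>F n in sequentially. cmod (\<psi> n ^ N n - (1 + (- (t\<^sup>2) / 2) / N n) ^ N n) \<le> \<bar>t\<bar> ^ 3 * C / 6 / sqrt (N n)"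
    using filterlim_at_top[THEN iffD1, rule_format, OF N, of "max 1 (nat \<lceil>t\<^sup>2 / 4\<rceil>)"]
  proof eventually_elim
    case (elim n)
    then have n: "N n > 0" "N n \<ge> t\<^sup>2 / 4"
      by (auto simp: nat_ceiling_le_eq)
    have \<psi>1: "cmod (\<psi> n) \<le> 1"
      unfolding \<psi>_def
      by (rule real_distribution.cmod_char_le_1[OF prob_space.real_distribution_distr[OF measure_pmf.prob_space_axioms]]) simp
    have "cmod (\<psi> n ^ N n - (complex_of_real (1 + (- (t\<^sup>2) / 2) / N n)) ^ N n)
        \<le> N n * cmod (\<psi> n - complex_of_real (1 + (- (t\<^sup>2) / 2) / N n))"
      using n \<psi>1
      by (intro norm_power_diff) (auto simp del: of_real_diff of_real_add simp: divide_le_eq intro!: abs_leI)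
    also have "\<dots> \<le> N n * (\<bar>t\<bar> ^ 3 * C / 6 / (N n * sqrt (N n)))"
      using \<psi>[OF n(1)] by (intro mult_left_mono) auto
    also have "\<dots> = \<bar>t\<bar> ^ 3 * C / 6 / sqrt (N n)"
      using n by simp
    finally show ?case
      by simp
  qed
  moreover have "(\<lambda>n. \<bar>t\<bar> ^ 3 * C / 6 / sqrt (N n)) \<longlonglongrightarrow> 0"
    by (intro tendsto_divide_0[OF tendsto_const] filterlim_at_top_imp_at_infinity
        filterlim_compose[OF sqrt_at_top] filterlim_compose[OF filterlim_real_sequentially N])
  ultimately have "(\<lambda>n. \<psi> n ^ N n - (1 + (- (t\<^sup>2) / 2) / N n) ^ N n) \<longlonglongrightarrow> 0"
    by (rule Lim_null_comparison)
  moreover have "(\<lambda>n. complex_of_real ((1 + (- (t\<^sup>2) / 2) / N n) ^ N n)) \<longlonglongrightarrow> complex_of_real (exp (- (t\<^sup>2) / 2))"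
    by (intro tendsto_of_real filterlim_compose[OF tendsto_exp_limit_sequentially N])
  ultimately have "(\<lambda>n. \<psi> n ^ N n) \<longlonglongrightarrow> complex_of_real (exp (- (t\<^sup>2) / 2))"
    using tendsto_add by fastforce
  then show "(\<lambda>n. char (distr (measure_pmf (replicate_pmf (N n) (q n))) borel
      (\<lambda>xs. sum_list xs / sqrt (N n))) t) \<longlonglongrightarrow> char std_normal_distribution t"
    by (simp add: char_eq char_std_normal_distribution)
qed (auto intro!: real_dist_normal_dist prob_space.real_distribution_distr[OF measure_pmf.prob_space_axioms])

text \<open>Mills' bound: \<open>1 \<le> x / c\<close> on the range of integration, and
  \<open>x * std_normal_density x\<close> has the explicit antiderivative
  \<open>- std_normal_density x\<close>.\<close>

lemma nn_integral_std_normal_tail: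
  assumes c: "0 < c"
  shows "(\<integral>\<^sup>+x. ennreal (std_normal_density x) * indicator {c..} x \<partial>lborel)
    \<le> ennreal (exp (- c\<^sup>2 / 2) / (c * sqrt (2 * pi)))"
proof -
  have "(\<integral>\<^sup>+x. ennreal (std_normal_density x) * indicator {c..} x \<partial>lborel)
      \<le> (\<integral>\<^sup>+x. ennreal (x * std_normal_density x / c) * indicator {c..} x \<partial>lborel)"
  proof (intro nn_integral_mono)
    fix x
    have "std_normal_density x \<le> x * std_normal_density x / c" if "c \<le> x"
      using c that mult_right_mono[of c x "std_normal_density x"] by (simp add: field_simps)
    then show "ennreal (std_normal_density x) * indicator {c..} x
        \<le> ennreal (x * std_normal_density x / c) * indicator {c..} x"
      by (auto split: split_indicator intro: ennreal_leI)
  qed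
  also have "\<dots> = ennreal (0 - (- std_normal_density c / c))"
  proof (rule nn_integral_FTC_atLeast[where F = "\<lambda>x. - std_normal_density x / c"])
    show "((\<lambda>x. - std_normal_density x / c) has_real_derivative x * std_normal_density x / c) (at x)" if "c \<le> x" for x
      unfolding std_normal_density_def using c
      by (auto intro!: derivative_eq_intros simp: field_simps)
    have "((\<lambda>x. exp (- x\<^sup>2 / 2)) \<longlongrightarrow> (0::real)) at_top"
      by real_asymp
    then have "((\<lambda>x. - ((1 / sqrt (2 * pi)) * exp (- x\<^sup>2 / 2)) / c) \<longlongrightarrow> - ((1 / sqrt (2 * pi)) * 0) / c) at_top"
      using c by (intro tendsto_intros) auto
    then show "((\<lambda>x. - std_normal_density x / c) \<longlongrightarrow> 0) at_top"
      unfolding std_normal_density_def by simp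
  qed (use c in auto)
  also have "0 - (- std_normal_density c / c) = exp (- c\<^sup>2 / 2) / (c * sqrt (2 * pi))"
    by (simp add: std_normal_density_def)
  finally show ?thesis .
qed

lemma measure_std_normal_tails:
  assumes c: "0 < c"
  shows "measure std_normal_distribution {c..} \<le> exp (- c\<^sup>2 / 2) / (c * sqrt (2 * pi))"
    and "measure std_normal_distribution {..-c} \<le> exp (- c\<^sup>2 / 2) / (c * sqrt (2 * pi))"
proof -
  interpret real_distribution std_normal_distribution
    by (rule real_dist_normal_dist)
  have "emeasure std_normal_distribution {c..} \<le> ennreal (exp (- c\<^sup>2 / 2) / (c * sqrt (2 * pi)))"
    using nn_integral_std_normal_tail[OF c] by (simp add: emeasure_density)
  then show "measure std_normal_distribution {c..} \<le> exp (- c\<^sup>2 / 2) / (c * sqrt (2 * pi))"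
    using c by (simp add: emeasure_eq_measure)
  have "emeasure std_normal_distribution {..-c}
      = (\<integral>\<^sup>+x. ennreal (std_normal_density x) * indicator {..-c} x \<partial>distr lborel borel uminus)"
    by (simp add: emeasure_density lborel_distr_uminus)
  also have "\<dots> = (\<integral>\<^sup>+x. ennreal (std_normal_density (- x)) * indicator {..-c} (- x) \<partial>lborel)"
    by (rule nn_integral_distr) auto
  also have "\<dots> = (\<integral>\<^sup>+x. ennreal (std_normal_density x) * indicator {c..} x \<partial>lborel)"
    by (intro nn_integral_cong) (auto simp: std_normal_density_def split: split_indicator)
  also have "\<dots> \<le> ennreal (exp (- c\<^sup>2 / 2) / (c * sqrt (2 * pi)))"
    by (rule nn_integral_std_normal_tail[OF c])
  finally show "measure std_normal_distribution {..-c} \<le> exp (- c\<^sup>2 / 2) / (c * sqrt (2 * pi))"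
    using c by (simp add: emeasure_eq_measure)
qed

text \<open>Weak convergence gives convergence of distribution functions only at continuity points
  of the limit; the normal law has no atoms, so every point qualifies.\<close>

lemma isCont_cdf_std_normal: "isCont (cdf std_normal_distribution) x"
proof -
  interpret real_distribution std_normal_distribution
    by (rule real_dist_normal_dist)
  have "AE y in lborel. ennreal (std_normal_density y) * indicator {x} y = 0"
    using AE_lborel_singleton[of x] by eventually_elim simp
  then have "emeasure std_normal_distribution {x} = 0"
    by (simp add: emeasure_density nn_integral_0_iff_AE)
  then show ?thesis
    by (simp add: isCont_cdf measure_def)
qed

text \<open>By contradiction: a sequence of violations would be a triangular array obeying the central
  limit theorem.\<close>

lemma uniform_clt_tail_bound:
  fixes C c \<kappa> :: real
  assumes c: "0 < c" and \<kappa>: "0 < \<kappa>"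
  obtains M0 :: nat where "\<And>M q. M0 \<le> M \<Longrightarrow> integrable (measure_pmf q) (\<lambda>x. \<bar>x\<bar> ^ 3) \<Longrightarrow>
      measure_pmf.expectation q (\<lambda>x. x) = 0 \<Longrightarrow>
      measure_pmf.expectation q (\<lambda>x. x\<^sup>2) = 1 \<Longrightarrow>
      measure_pmf.expectation q (\<lambda>x. \<bar>x\<bar> ^ 3) \<le> C \<Longrightarrow>
      measure_pmf.prob (replicate_pmf M q) {xs. \<bar>sum_list xs\<bar> > c * sqrt M}
        \<le> 2 * (exp (- c\<^sup>2 / 2) / (c * sqrt (2 * pi))) + \<kappa>"
proof -
  let ?T = "exp (- c\<^sup>2 / 2) / (c * sqrt (2 * pi))"
  let ?good = "\<lambda>q. integrable (measure_pmf q) (\<lambda>x. \<bar>x\<bar> ^ 3) \<and>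
      measure_pmf.expectation q (\<lambda>x. x) = 0 \<and>
      measure_pmf.expectation q (\<lambda>x. x\<^sup>2) = 1 \<and>
      measure_pmf.expectation q (\<lambda>x. \<bar>x\<bar> ^ 3) \<le> C"
  let ?P = "\<lambda>M q. measure_pmf.prob (replicate_pmf M q) {xs. \<bar>sum_list xs\<bar> > c * sqrt (real M)}"
  have "\<exists>M0. \<forall>M\<ge>M0. \<forall>q. ?good q \<longrightarrow> ?P M q \<le> 2 * ?T + \<kappa>"
  proof (rule ccontr)
    assume "\<not> ?thesis"
    \<comment> \<open>Refuting the threshold \<open>Suc n\<close> yields a violation with
      \<open>M\<close> strictly above \<open>n\<close>; the sample sizes are thus positive and tend
      to infinity.\<close>
    then have "\<exists>M q. n < M \<and> ?good q \<and> \<not> ?P M q \<le> 2 * ?T + \<kappa>" for n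
      by (meson Suc_le_eq)
    then obtain N q where N: "\<And>n. n < N n" and q: "\<And>n. ?good (q n)"
      and bad: "\<And>n. \<not> ?P (N n) (q n) \<le> 2 * ?T + \<kappa>"
      by metis
    have N_lim: "filterlim N at_top sequentially"
      by (rule filterlim_at_top_mono[OF filterlim_ident]) (use N in \<open>auto intro!: always_eventually less_imp_le\<close>)
    interpret std: real_distribution std_normal_distribution
      by (rule real_dist_normal_dist)
    define D where "D n = distr (measure_pmf (replicate_pmf (N n) (q n))) borel
      (\<lambda>xs. sum_list xs / sqrt (N n))" for n
    have "weak_conv_m D std_normal_distribution"
      unfolding D_def by (rule central_limit_third_moment[OF N_lim]) (use q in auto)
    then have "(\<lambda>n. cdf (D n) x) \<longlonglongrightarrow> cdf std_normal_distribution x" for x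
      using isCont_cdf_std_normal by (auto simp: weak_conv_m_def weak_conv_def)
    then have "(\<lambda>n. 1 - cdf (D n) c + cdf (D n) (- c)) \<longlonglongrightarrow>
        1 - cdf std_normal_distribution c + cdf std_normal_distribution (- c)"
      by (intro tendsto_intros)
    moreover have "1 - cdf std_normal_distribution c + cdf std_normal_distribution (- c) < 2 * ?T + \<kappa>"
    proof -
      have "1 - cdf std_normal_distribution c = measure std_normal_distribution (space std_normal_distribution - {..c})"
        by (subst std.prob_compl) (auto simp: cdf_def)
      also have "\<dots> \<le> measure std_normal_distribution {c..}"
        by (rule std.finite_measure_mono) auto
      finally show ?thesis
        using measure_std_normal_tails[OF c] \<kappa> by (simp add: cdf_def)
    qed
    ultimately have "\<forall>\<^sub>F n in sequentially. 1 - cdf (D n) c + cdf (D n) (- c) < 2 * ?T + \<kappa>"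
      by (rule order_tendstoD)
    then obtain n where n: "1 - cdf (D n) c + cdf (D n) (- c) < 2 * ?T + \<kappa>"
      by (auto simp: eventually_sequentially)
    let ?R = "replicate_pmf (N n) (q n)"
    have s: "sqrt (N n) > 0"
      using N[of n] by simp
    have cdf_D: "cdf (D n) x = measure_pmf.prob ?R {xs. sum_list xs \<le> x * sqrt (N n)}" for x
      using s by (simp add: D_def cdf_def measure_distr vimage_def divide_le_eq)
    \<comment> \<open>The lower tail is enlarged by its endpoint, so that both tails can be read off
      the distribution function.\<close>
    have "?P (N n) (q n) \<le> measure_pmf.prob ?R
        ((UNIV - {xs. sum_list xs \<le> c * sqrt (N n)}) \<union> {xs. sum_list xs \<le> - c * sqrt (N n)})"
      by (rule measure_pmf.finite_measure_mono) auto
    also have "\<dots> \<le> measure_pmf.prob ?R (UNIV - {xs. sum_list xs \<le> c * sqrt (N n)})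
        + measure_pmf.prob ?R {xs. sum_list xs \<le> - c * sqrt (N n)}"
      by (rule measure_Un_le) auto
    also have "\<dots> = 1 - cdf (D n) c + cdf (D n) (- c)"
      using measure_pmf.prob_compl[of "{xs. sum_list xs \<le> c * sqrt (N n)}" ?R]
      by (simp add: cdf_D)
    finally show False
      using n bad[of n] by linarith
  qed
  then show thesis
    using that by blast
qed

section \<open>Chebyshev and Markov inequalities for sums of independent draws\<close>

lemma nn_integral_replicate_pmf_sum_list:
  fixes g :: "'a \<Rightarrow> ennreal"
  shows "(\<integral>\<^sup>+xs. sum_list (map g xs) \<partial>replicate_pmf n p) = of_nat n * (\<integral>\<^sup>+x. g x \<partial>p)"
  by (induction n) (simp_all add: nn_integral_add distrib_right measure_pmf.emeasure_space_1)

text \<open>Second moments of independent centred variables add: in the square of a sum the cross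
  term integrates to zero.\<close>

lemma nn_integral_replicate_pmf_sum_list_square:
  fixes f :: "'a \<Rightarrow> real"
  assumes int: "integrable (measure_pmf p) f" and mean: "measure_pmf.expectation p f = 0"
    and int2: "integrable (measure_pmf p) (\<lambda>x. (f x)\<^sup>2)"
  shows "(\<integral>\<^sup>+xs. ennreal ((sum_list (map f xs))\<^sup>2) \<partial>replicate_pmf n p)
    = of_nat n * (\<integral>\<^sup>+x. ennreal ((f x)\<^sup>2) \<partial>p)"
proof (induction n)
  case (Suc n)
  have step: "(\<integral>\<^sup>+x. ennreal ((f x + s)\<^sup>2) \<partial>p) = (\<integral>\<^sup>+x. ennreal ((f x)\<^sup>2) \<partial>p) + ennreal (s\<^sup>2)" for s
  proof -
    have i: "integrable (measure_pmf p) (\<lambda>x. (f x)\<^sup>2 + s\<^sup>2 + 2 * f x * s)"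
      using int int2 by auto
    have "(\<integral>\<^sup>+x. ennreal ((f x + s)\<^sup>2) \<partial>p) = ennreal (measure_pmf.expectation p (\<lambda>x. (f x)\<^sup>2 + s\<^sup>2 + 2 * f x * s))"
      unfolding power2_sum by (rule nn_integral_eq_integral[OF i]) (simp flip: power2_sum)
    also have "measure_pmf.expectation p (\<lambda>x. (f x)\<^sup>2 + s\<^sup>2 + 2 * f x * s)
        = measure_pmf.expectation p (\<lambda>x. (f x)\<^sup>2) + s\<^sup>2"
      using int int2 mean by simp
    also have "ennreal \<dots> = ennreal (measure_pmf.expectation p (\<lambda>x. (f x)\<^sup>2)) + ennreal (s\<^sup>2)"
      by (simp add: ennreal_plus)
    also have "ennreal (measure_pmf.expectation p (\<lambda>x. (f x)\<^sup>2)) = (\<integral>\<^sup>+x. ennreal ((f x)\<^sup>2) \<partial>p)"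
      by (rule nn_integral_eq_integral[OF int2, symmetric]) simp
    finally show ?thesis .
  qed
  \<comment> \<open>The new draw is moved into the inner integral, where the sum of the other draws
    is a constant \<open>s\<close>.\<close>
  have "replicate_pmf (Suc n) p = do {xs \<leftarrow> replicate_pmf n p; x \<leftarrow> p; return_pmf (x # xs)}"
    by (simp add: bind_commute_pmf[of p])
  then have "(\<integral>\<^sup>+xs. ennreal ((sum_list (map f xs))\<^sup>2) \<partial>replicate_pmf (Suc n) p)
    = (\<integral>\<^sup>+xs. \<integral>\<^sup>+x. ennreal ((f x + sum_list (map f xs))\<^sup>2) \<partial>p \<partial>replicate_pmf n p)"
    by (simp del: replicate_pmf.simps)
  also have "\<dots> = (\<integral>\<^sup>+x. ennreal ((f x)\<^sup>2) \<partial>p) + of_nat n * (\<integral>\<^sup>+x. ennreal ((f x)\<^sup>2) \<partial>p)"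
    unfolding step by (simp add: nn_integral_add Suc.IH measure_pmf.emeasure_space_1)
  finally show ?case
    by (simp add: distrib_right)
qed simp

lemma replicate_pmf_chebyshev:
  fixes f :: "'a \<Rightarrow> real" and a C :: real and n :: nat
  assumes int: "integrable (measure_pmf p) f" and mean: "measure_pmf.expectation p f = 0"
    and second: "(\<integral>\<^sup>+x. ennreal ((f x)\<^sup>2) \<partial>p) \<le> ennreal C" and a: "0 < a" and n: "0 < n" and C: "0 \<le> C"
  shows "measure_pmf.prob (replicate_pmf n p) {xs. \<bar>sum_list (map f xs)\<bar> > a * n} \<le> C / (a\<^sup>2 * n)"
proof -
  have int2: "integrable (measure_pmf p) (\<lambda>x. (f x)\<^sup>2)"
    by (rule integrableI_bounded) (use second in \<open>auto simp: le_less_trans\<close>)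
  have an: "0 < a * n"
    using a n by simp
  let ?S = "\<lambda>xs. sum_list (map f xs)"
  have "emeasure (replicate_pmf n p) {xs. \<bar>?S xs\<bar> > a * n}
      = (\<integral>\<^sup>+xs. indicator {xs. \<bar>?S xs\<bar> > a * n} xs \<partial>replicate_pmf n p)"
    by simp
  also have "\<dots> \<le> (\<integral>\<^sup>+xs. ennreal (1 / (a * n)\<^sup>2) * ennreal ((?S xs)\<^sup>2) \<partial>replicate_pmf n p)"
  proof (intro nn_integral_mono)
    fix xs
    have "1 \<le> 1 / (a * n)\<^sup>2 * (?S xs)\<^sup>2" if "a * n < \<bar>?S xs\<bar>"
    proof -
      have "(a * n)\<^sup>2 \<le> \<bar>?S xs\<bar>\<^sup>2"
        using an that by (intro power_mono) auto
      then show ?thesis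
        by (simp only: times_divide_eq_left mult_1 power2_abs le_divide_eq_1_pos[OF zero_less_power[OF an]])
    qed
    then show "indicator {xs. \<bar>?S xs\<bar> > a * n} xs \<le> ennreal (1 / (a * n)\<^sup>2) * ennreal ((?S xs)\<^sup>2)"
      by (auto split: split_indicator simp flip: ennreal_mult ennreal_1 intro!: ennreal_leI)
  qed
  also have "\<dots> = ennreal (1 / (a * n)\<^sup>2) * (of_nat n * (\<integral>\<^sup>+x. ennreal ((f x)\<^sup>2) \<partial>p))"
    by (simp add: nn_integral_cmult nn_integral_replicate_pmf_sum_list_square[OF int mean int2])
  also have "\<dots> \<le> ennreal (1 / (a * n)\<^sup>2) * (of_nat n * ennreal C)"
    by (intro mult_left_mono second) auto
  also have "\<dots> = ennreal (1 / (a * n)\<^sup>2 * (real n * C))"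
    using C by (simp add: ennreal_of_nat_eq_real_of_nat flip: ennreal_mult)
  also have "1 / (a * n)\<^sup>2 * (real n * C) = C / (a\<^sup>2 * n)"
    using a n by (simp add: power2_eq_square field_simps)
  finally show ?thesis
    using C by (simp add: measure_pmf.emeasure_eq_measure)
qed

text \<open>\<open>g\<close> takes values in \<open>ennreal\<close> because the bound is meant for
  \<open>third_sup\<close>, a supremum that is not known in advance to be finite.\<close>

lemma replicate_pmf_markov:
  fixes g :: "'a \<Rightarrow> ennreal" and a C :: real and n :: nat
  assumes g: "(\<integral>\<^sup>+x. g x \<partial>measure_pmf p) \<le> ennreal C" and a: "0 < a" and n: "0 < n" and C: "0 \<le> C"
  shows "measure_pmf.prob (replicate_pmf n p) {xs. sum_list (map g xs) > ennreal (a * n)} \<le> C / a"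
proof -
  have an: "0 < a * n"
    using a n by simp
  let ?S = "\<lambda>xs. sum_list (map g xs)"
  have "emeasure (replicate_pmf n p) {xs. ?S xs > ennreal (a * n)}
      = (\<integral>\<^sup>+xs. indicator {xs. ?S xs > ennreal (a * n)} xs \<partial>replicate_pmf n p)"
    by simp
  also have "\<dots> \<le> (\<integral>\<^sup>+xs. ennreal (1 / (a * n)) * ?S xs \<partial>replicate_pmf n p)"
  proof (intro nn_integral_mono)
    fix xs
    have "1 \<le> ennreal (1 / (a * n)) * ?S xs" if "ennreal (a * n) < ?S xs"
    proof -
      have "1 = ennreal (1 / (a * n)) * ennreal (a * n)"
        using a n by (simp flip: ennreal_mult)
      also have "\<dots> \<le> ennreal (1 / (a * n)) * ?S xs"
        using that by (intro mult_left_mono) auto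
      finally show ?thesis .
    qed
    then show "indicator {xs. ?S xs > ennreal (a * n)} xs \<le> ennreal (1 / (a * n)) * ?S xs"
      by (auto split: split_indicator)
  qed
  also have "\<dots> = ennreal (1 / (a * n)) * (of_nat n * (\<integral>\<^sup>+x. g x \<partial>p))"
    by (simp add: nn_integral_cmult nn_integral_replicate_pmf_sum_list)
  also have "\<dots> \<le> ennreal (1 / (a * n)) * (of_nat n * ennreal C)"
    by (intro mult_left_mono g) auto
  also have "\<dots> = ennreal (1 / (a * n) * (real n * C))"
    using C a n by (simp add: ennreal_of_nat_eq_real_of_nat flip: ennreal_mult)
  also have "1 / (a * n) * (real n * C) = C / a"
    using a n by simp
  finally show ?thesis
    using C a by (simp add: measure_pmf.emeasure_eq_measure)
qed

section \<open>Gaussian tails, matrices and fixed points\<close>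

text \<open>\<open>Lambert_W0\<close> is a definite description, so existence and uniqueness are
  both owed. Existence is the intermediate value theorem on the interval from 0 to \<open>x\<close>.
  For uniqueness, positive \<open>x\<close> forces a positive solution, and \<open>w * exp w\<close>
  is strictly increasing there.\<close>

lemma Lambert_W0_pos:
  assumes "0 < x"
  shows "0 < Lambert_W0 x" "Lambert_W0 x * exp (Lambert_W0 x) = x"
proof -
  have "\<exists>w\<ge>0. w \<le> x \<and> w * exp w = x"
    by (rule IVT') (use assms in \<open>auto intro!: continuous_intros simp: mult_le_cancel_left1\<close>)
  then obtain w where w: "0 \<le> w" "w * exp w = x"
    by blast
  have pos: "0 < v" if "v * exp v = x" for v
    using that assms zero_less_mult_pos2[of v "exp v"] by simp
  have less: "u * exp u < v * exp v" if "0 < u" "u < v" for u v :: real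
    using that by (intro mult_strict_mono) auto
  have "Lambert_W0 x = w"
    unfolding Lambert_W0_def
  proof (rule the_equality)
    fix v :: real
    assume "- 1 \<le> v \<and> v * exp v = x"
    then show "v = w"
      using pos[of v] pos[of w] less[of v w] less[of w v] w by (cases v w rule: linorder_cases) auto
  qed (use w in auto)
  then show "0 < Lambert_W0 x" "Lambert_W0 x * exp (Lambert_W0 x) = x"
    using w pos[of w] by auto
qed

text \<open>The constant 8, in place of the 2 that a union bound over the coordinates would need, makes these
  tails add up to only half of \<open>\<delta>\<close>; the other half pays for the failure of the linearization.\<close>

lemma gaussian_tail_Lambert_W0:
  assumes "0 < \<delta>" "0 < d"
  defines "W \<equiv> Lambert_W0 (8 / (pi * \<delta>\<^sup>2) * d\<^sup>2)"
  shows "2 * (exp (- (sqrt W)\<^sup>2 / 2) / (sqrt W * sqrt (2 * pi))) = \<delta> / (2 * d)"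
proof -
  let ?x = "8 / (pi * \<delta>\<^sup>2) * d\<^sup>2"
  have W: "0 < W" "W * exp W = ?x"
    unfolding W_def by (rule Lambert_W0_pos; use assms in simp)+
  have "sqrt W * exp (W / 2) = sqrt (W * exp W)"
  proof (rule real_sqrt_unique[symmetric])
    show "(sqrt W * exp (W / 2))\<^sup>2 = W * exp W"
      using W by (simp add: power_mult_distrib flip: exp_double)
  qed (use W in simp)
  then have "sqrt W * exp (W / 2) = sqrt ?x"
    by (simp only: W(2))
  moreover have "sqrt W * sqrt (2 * pi) / exp (- W / 2) = sqrt W * exp (W / 2) * sqrt (2 * pi)"
    by (simp add: exp_minus field_simps)
  ultimately have "sqrt W * sqrt (2 * pi) / exp (- W / 2) = sqrt (?x * (2 * pi))"
    by (simp only: real_sqrt_mult)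
  \<comment> \<open>The \<open>pi\<close> in the argument of \<open>Lambert_W0\<close> cancels the
    Gaussian normalization, and 8 times 2 is a perfect square.\<close>
  also have "?x * (2 * pi) = (4 * d / \<delta>)\<^sup>2"
    using assms by (simp add: power2_eq_square field_simps)
  also have "sqrt \<dots> = 4 * d / \<delta>"
    using assms by simp
  finally have *: "sqrt W * sqrt (2 * pi) / exp (- W / 2) = 4 * d / \<delta>" .
  have "exp (- (sqrt W)\<^sup>2 / 2) / (sqrt W * sqrt (2 * pi))
      = inverse (sqrt W * sqrt (2 * pi) / exp (- W / 2))"
    using W by simp
  then show ?thesis
    unfolding * by simp
qed

section \<open>Matrix norms, inverses and second-moment matrices\<close>

lemma norm_matrix_vector_le_op_norm:
  fixes A :: "real^'n^'n"
  shows "norm (A *v v) \<le> op_norm A * norm v"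
  unfolding op_norm_def by (rule onorm[OF matrix_vector_mul_bounded_linear])

lemma diagonal_le_op_norm:
  fixes A :: "real^'n^'n"
  shows "A $ a $ a \<le> op_norm A"
proof -
  have "A $ a $ a = (A *v axis a 1) $ a"
    by (simp add: matrix_vector_mult_basis column_def)
  also have "\<dots> \<le> norm (A *v axis a 1)"
    using component_le_norm_cart[of "A *v axis a 1" a] by simp
  also have "\<dots> \<le> op_norm A"
    using norm_matrix_vector_le_op_norm[of A "axis a 1"] by (simp add: norm_axis_1)
  finally show ?thesis .
qed

text \<open>The dimensional factor is crude but harmless: the dimension is fixed, and the entrywise
  bound is chosen later with \<open>CARD('n)\<close> squared in its denominator.\<close>

lemma norm_matrix_vector_le_entries:
  fixes A :: "real^'n^'n"
  assumes "\<And>i j. \<bar>A $ i $ j\<bar> \<le> e"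
  shows "norm (A *v v) \<le> (real CARD('n))\<^sup>2 * e * norm v"
proof -
  have "norm (A *v v) \<le> (\<Sum>i\<in>UNIV. \<bar>(A *v v) $ i\<bar>)"
    by (rule norm_le_l1_cart)
  also have "\<dots> \<le> (\<Sum>i\<in>(UNIV::'n set). \<Sum>j\<in>(UNIV::'n set). e * norm v)"
  proof (rule sum_mono)
    fix i
    have "\<bar>(A *v v) $ i\<bar> \<le> (\<Sum>j\<in>UNIV. \<bar>A $ i $ j * v $ j\<bar>)"
      unfolding matrix_vector_mult_def vec_lambda_beta by (rule sum_abs)
    also have "\<dots> \<le> (\<Sum>j\<in>(UNIV::'n set). e * norm v)"
      unfolding abs_mult
      by (intro sum_mono mult_mono assms component_le_norm_cart order_trans[OF abs_ge_zero assms]) auto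
    finally show "\<bar>(A *v v) $ i\<bar> \<le> (\<Sum>j\<in>(UNIV::'n set). e * norm v)" .
  qed
  also have "\<dots> = (real CARD('n))\<^sup>2 * e * norm v"
    by (simp add: power2_eq_square)
  finally show ?thesis .
qed

text \<open>The origin of the leading factor \<open>d\<close> in the final bound: passing from
  coordinates to the Euclidean norm costs \<open>sqrt d\<close> in the radius, hence
  \<open>d\<close> in the number of repetitions.\<close>

lemma norm_le_sqrt_card:
  fixes v :: "real^'n"
  assumes "\<And>i. \<bar>v $ i\<bar> \<le> e"
  shows "norm v \<le> sqrt (real CARD('n)) * e"
proof -
  have e: "0 \<le> e"
    by (rule order_trans[OF abs_ge_zero assms])
  have "(v $ i)\<^sup>2 \<le> e\<^sup>2" for i
    using power_mono[OF assms abs_ge_zero, of i 2] by simp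
  then have "(\<Sum>i\<in>UNIV. (v $ i)\<^sup>2) \<le> (\<Sum>i\<in>(UNIV::'n set). e\<^sup>2)"
    by (intro sum_mono)
  then have "sqrt (\<Sum>i\<in>UNIV. (v $ i)\<^sup>2) \<le> sqrt (real CARD('n) * e\<^sup>2)"
    by simp
  then show ?thesis
    using e by (simp add: norm_vec_def L2_set_def real_sqrt_mult)
qed

lemma has_bochner_integral_entry:
  fixes f :: "'x \<Rightarrow> real^'n^'m"
  assumes "has_bochner_integral M f A"
  shows "has_bochner_integral M (\<lambda>x. f x $ i $ j) (A $ i $ j)"
  using has_bochner_integral_bounded_linear[OF bounded_linear_vec_nth
      has_bochner_integral_bounded_linear[OF bounded_linear_vec_nth assms]] .

lemma matrix_inv_inverse:
  fixes A :: "real^'n^'n"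
  assumes "invertible A"
  shows "A ** matrix_inv A = mat 1" "matrix_inv A ** A = mat 1"
proof -
  obtain B where "A ** B = mat 1 \<and> B ** A = mat 1"
    using assms by (auto simp: invertible_def)
  then have "A ** matrix_inv A = mat 1 \<and> matrix_inv A ** A = mat 1"
    unfolding matrix_inv_def by (rule someI)
  then show "A ** matrix_inv A = mat 1" "matrix_inv A ** A = mat 1"
    by auto
qed

lemma matrix_inv_symmetric:
  fixes A :: "real^'n^'n"
  assumes "invertible A" "transpose A = A"
  shows "transpose (matrix_inv A) = matrix_inv A"
proof -
  note I = matrix_inv_inverse[OF assms(1)]
  have "transpose (matrix_inv A) ** A = transpose (A ** matrix_inv A)"
    by (simp add: matrix_transpose_mul assms(2))
  also have "\<dots> = mat 1"
    by (simp add: I transpose_mat)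
  finally have "transpose (matrix_inv A) ** (A ** matrix_inv A) = matrix_inv A"
    by (simp add: matrix_mul_assoc)
  then show ?thesis
    by (simp add: I)
qed

context
  fixes M :: "'x measure" and g :: "'x \<Rightarrow> real^'n" and F :: "real^'n^'n"
  assumes F: "has_bochner_integral M (\<lambda>x. outer_self (g x)) F"
begin

lemma second_moment_symmetric: "transpose F = F"
proof -
  have "has_bochner_integral M (\<lambda>x. g x $ i * g x $ j) (F $ i $ j)" for i j
    using has_bochner_integral_entry[OF F, of i j] by (simp add: outer_self_def)
  then have "F $ i $ j = F $ j $ i" for i j
    using has_bochner_integral_eq by (metis (no_types, lifting) ext mult.commute)
  then show ?thesis
    by (simp add: transpose_def vec_eq_iff)
qed

lemma second_moment_inner:
  "has_bochner_integral M (\<lambda>x. (v \<bullet> g x) * (w \<bullet> g x)) (v \<bullet> (F *v w))"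
proof -
  have "has_bochner_integral M (\<lambda>x. \<Sum>i\<in>UNIV. \<Sum>j\<in>UNIV. (v $ i * w $ j) * outer_self (g x) $ i $ j)
     (\<Sum>i\<in>UNIV. \<Sum>j\<in>UNIV. (v $ i * w $ j) * F $ i $ j)"
    by (intro has_bochner_integral_sum has_bochner_integral_mult_right has_bochner_integral_entry F)
  also have "(\<lambda>x. \<Sum>i\<in>UNIV. \<Sum>j\<in>UNIV. (v $ i * w $ j) * outer_self (g x) $ i $ j)
      = (\<lambda>x. (v \<bullet> g x) * (w \<bullet> g x))"
    by (simp add: outer_self_def inner_vec_def sum_product mult_ac)
  also have "(\<Sum>i\<in>UNIV. \<Sum>j\<in>UNIV. (v $ i * w $ j) * F $ i $ j) = v \<bullet> (F *v w)"
    by (simp add: inner_vec_def matrix_vector_mult_def sum_distrib_left mult_ac)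
  finally show ?thesis .
qed

text \<open>With \<open>w = matrix_inv F *v axis a 1\<close>, symmetry turns coordinate
  \<open>a\<close> of the whitened vector into \<open>w \<bullet> g x\<close>, and
  \<open>F *v w = axis a 1\<close> evaluates its second moment. Were that moment zero,
  \<open>w \<bullet> g x\<close> would vanish almost everywhere and so would
  \<open>F *v w\<close>.\<close>

lemma whitened_second_moment:
  assumes inv: "invertible F"
  shows "has_bochner_integral M (\<lambda>x. ((matrix_inv F *v g x) $ a)\<^sup>2) (matrix_inv F $ a $ a)"
    and "0 < matrix_inv F $ a $ a"
proof -
  note I = matrix_inv_inverse[OF inv]
  define w where "w = matrix_inv F *v axis a 1"
  have sym: "matrix_inv F $ i $ j = matrix_inv F $ j $ i" for i j
  proof -
    have "matrix_inv F $ i $ j = transpose (matrix_inv F) $ i $ j"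
      by (simp only: matrix_inv_symmetric[OF inv second_moment_symmetric])
    then show ?thesis
      by (simp add: transpose_def)
  qed
  have w: "w $ j = matrix_inv F $ a $ j" for j
    using sym[of a j] by (simp add: w_def matrix_vector_mult_basis column_def)
  have Fw: "F *v w = axis a 1"
    by (simp add: w_def matrix_vector_mul_assoc I)
  have wg: "w \<bullet> v = (matrix_inv F *v v) $ a" for v
    by (simp add: inner_vec_def matrix_vector_mult_def w)
  have val: "w \<bullet> (F *v w) = matrix_inv F $ a $ a"
    by (simp add: Fw inner_axis w)
  show *: "has_bochner_integral M (\<lambda>x. ((matrix_inv F *v g x) $ a)\<^sup>2) (matrix_inv F $ a $ a)"
    using second_moment_inner[of w w, unfolded val] unfolding wg power2_eq_square .
  have "0 \<le> matrix_inv F $ a $ a"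
    using has_bochner_integral_integral_eq[OF *] Bochner_Integration.integral_nonneg[of M "\<lambda>x. ((matrix_inv F *v g x) $ a)\<^sup>2"] by simp
  moreover have "matrix_inv F $ a $ a \<noteq> 0"
  proof
    assume 0: "matrix_inv F $ a $ a = 0"
    have "AE x in M. ((matrix_inv F *v g x) $ a)\<^sup>2 = 0"
      using * 0 by (subst integral_nonneg_eq_0_iff_AE[symmetric]) (auto simp: has_bochner_integral_iff)
    then have ae: "AE x in M. w \<bullet> g x = 0"
      by (simp add: wg)
    have "v \<bullet> (F *v w) = 0" for v
    proof -
      have "v \<bullet> (F *v w) = (\<integral>x. (v \<bullet> g x) * (w \<bullet> g x) \<partial>M)"
        using second_moment_inner by (simp add: has_bochner_integral_iff)
      also have "\<dots> = (\<integral>x. 0 \<partial>M)"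
        by (rule integral_cong_AE) (use ae second_moment_inner[of v w] in \<open>auto simp: has_bochner_integral_iff\<close>)
      finally show ?thesis by simp
    qed
    from this[of "axis a 1"] show False
      by (simp add: Fw inner_axis)
  qed
  ultimately show "0 < matrix_inv F $ a $ a"
    by simp
qed

end

text \<open>The linear part of \<open>B *v G \<Delta>\<close> cancels \<open>\<Delta>\<close>, so
  only the value at 0 and the remainder are left to bound. Brouwer's theorem asks for the size of
  the remainder alone, where a contraction argument would need its Lipschitz constant.\<close>

lemma near_linear_map_has_zero:
  fixes G :: "real^'n \<Rightarrow> real^'n" and F B :: "real^'n^'n"
  assumes \<epsilon>: "0 \<le> \<epsilon>" and inv: "F ** B = mat 1" "B ** F = mat 1"
    and cont: "continuous_on (cball 0 \<epsilon>) G"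
    and lin: "\<And>\<Delta>. norm \<Delta> \<le> \<epsilon> \<Longrightarrow> norm (G \<Delta> - G 0 + F *v \<Delta>) \<le> \<rho>"
    and C: "op_norm B \<le> C" and small: "norm (B *v G 0) + C * \<rho> \<le> \<epsilon>"
  obtains \<Delta> where "norm \<Delta> \<le> \<epsilon>" "G \<Delta> = 0"
proof -
  define \<Phi> where "\<Phi> \<Delta> = \<Delta> + B *v G \<Delta>" for \<Delta>
  have "norm (\<Phi> \<Delta>) \<le> \<epsilon>" if \<Delta>: "norm \<Delta> \<le> \<epsilon>" for \<Delta>
  proof -
    have "\<Phi> \<Delta> = B *v G 0 + B *v (G \<Delta> - G 0 + F *v \<Delta>)"
      by (simp add: \<Phi>_def matrix_vector_mul_assoc inv algebra_simps)
    also have "norm \<dots> \<le> norm (B *v G 0) + op_norm B * norm (G \<Delta> - G 0 + F *v \<Delta>)"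
      by (rule norm_triangle_mono[OF order_refl norm_matrix_vector_le_op_norm])
    also have "op_norm B * norm (G \<Delta> - G 0 + F *v \<Delta>) \<le> C * \<rho>"
    proof (rule mult_mono[OF C lin[OF \<Delta>]])
      have "0 \<le> op_norm B"
        unfolding op_norm_def by (rule onorm_pos_le[OF matrix_vector_mul_bounded_linear])
      then show "0 \<le> C"
        using C by linarith
    qed simp
    finally show ?thesis
      using small by linarith
  qed
  then have "\<Phi> \<in> cball 0 \<epsilon> \<rightarrow> cball 0 \<epsilon>"
    by auto
  moreover have "continuous_on (cball 0 \<epsilon>) \<Phi>"
    unfolding \<Phi>_def
    by (intro continuous_intros cont bounded_linear.continuous_on[OF matrix_vector_mul_bounded_linear])
  ultimately obtain \<Delta> where \<Delta>: "\<Delta> \<in> cball 0 \<epsilon>" "\<Phi> \<Delta> = \<Delta>"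
    using brouwer[of "cball 0 \<epsilon>" \<Phi>] \<epsilon> by auto
  have "G \<Delta> = F *v (B *v G \<Delta>)"
    by (simp add: matrix_vector_mul_assoc inv)
  also have "B *v G \<Delta> = 0"
    using \<Delta>(2) by (simp add: \<Phi>_def)
  finally show thesis
    using that[of \<Delta>] \<Delta>(1) by simp
qed

lemma SUP_less_infinity_bound:
  fixes f :: "'a \<Rightarrow> ennreal"
  assumes "(SUP x\<in>A. f x) < \<infinity>"
  obtains C where "0 < C" "\<And>x. x \<in> A \<Longrightarrow> f x \<le> ennreal C"
proof -
  obtain c where c: "0 \<le> c" "(SUP x\<in>A. f x) = ennreal c"
    using assms by (cases "SUP x\<in>A. f x") auto
  \<comment> \<open>Adding 1 makes the bound strictly positive, so that later constants may divide
    by it.\<close>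
  show thesis
  proof (rule that[of "c + 1"])
    fix x assume "x \<in> A"
    then have "f x \<le> ennreal c"
      using c(2) by (metis SUP_upper)
    also have "\<dots> \<le> ennreal (c + 1)"
      by (intro ennreal_leI) simp
    finally show "f x \<le> ennreal (c + 1)" .
  qed (use c in simp)
qed

section \<open>Maximum-likelihood estimation\<close>

lemma map_replicate_pmf:
  "replicate_pmf n (map_pmf f p) = map_pmf (map f) (replicate_pmf n p)"
  by (induction n) (simp_all add: map_bind_pmf bind_map_pmf)

lemma data_log_lik_single [simp]: "data_log_lik p [x] = log_lik p x"
  by (simp add: data_log_lik_def fun_eq_iff)

lemma gradient_data_log_lik:
  assumes "\<And>x. x \<in> set xs \<Longrightarrow> log_lik p x differentiable (at s)"
  shows "gradient (data_log_lik p xs) s = sum_list (map (\<lambda>x. gradient (log_lik p x) s) xs)"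
proof -
  have "(data_log_lik p xs has_derivative (\<lambda>h. sum_list (map (\<lambda>x. frechet_derivative (log_lik p x) (at s) h) xs))) (at s)"
    using assms
  proof (induction xs)
    case Nil
    then show ?case by (simp add: data_log_lik_def[abs_def])
  next
    case (Cons x xs)
    have "(log_lik p x has_derivative frechet_derivative (log_lik p x) (at s)) (at s)"
      using Cons.prems by (simp add: frechet_derivative_works)
    from has_derivative_add[OF this Cons.IH] Cons.prems show ?case
      by (simp add: data_log_lik_def[abs_def])
  qed
  note D = this
  have "partial_deriv i (data_log_lik p xs) s = sum_list (map (\<lambda>x. partial_deriv i (log_lik p x) s) xs)" for i
    unfolding partial_deriv_def frechet_derivative_at[OF D, symmetric] ..
  moreover have "sum_list (map (\<lambda>x. gradient (log_lik p x) s) xs) $ i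
      = sum_list (map (\<lambda>x. partial_deriv i (log_lik p x) s) xs)" for i
    by (induction xs) (simp_all add: gradient_def)
  ultimately show "gradient (data_log_lik p xs) s = sum_list (map (\<lambda>x. gradient (log_lik p x) s) xs)"
    by (simp add: vec_eq_iff) (simp add: gradient_def)
qed

lemma norm_sum_list_le:
  fixes f :: "'a \<Rightarrow> 'b::real_normed_vector"
  assumes "\<And>x. x \<in> set xs \<Longrightarrow> norm (f x) \<le> h x"
  shows "norm (sum_list (map f xs)) \<le> sum_list (map h xs)"
  using assms
proof (induction xs)
  case (Cons x xs)
  then show ?case
    using norm_triangle_mono[of "f x" "h x" "sum_list (map f xs)" "sum_list (map h xs)"] by simp
qed simp

lemma sum_list_ennreal:
  assumes "\<And>x. x \<in> set xs \<Longrightarrow> 0 \<le> g x"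
  shows "sum_list (map (\<lambda>x. ennreal (g x)) xs) = ennreal (sum_list (map g xs))"
  using assms
proof (induction xs)
  case (Cons x xs)
  then have "0 \<le> sum_list (map g xs)"
    by (intro sum_list_nonneg) auto
  with Cons show ?case
    by (simp add: ennreal_plus)
qed simp

text \<open>\<open>arg_max_on\<close> is a choice operator; its value is determined because the set
  of maximizers is a singleton.\<close>

lemma mle_eq_unique_maximizer:
  assumes "{s. is_arg_max (data_log_lik p xs) (\<lambda>s. s \<in> \<Theta>) s} = {t}"
  shows "mle p \<Theta> xs = t"
proof -
  have "is_arg_max (data_log_lik p xs) (\<lambda>s. s \<in> \<Theta>) s \<longleftrightarrow> s = t" for s
    using assms by blast
  then show ?thesis
    by (simp add: mle_def arg_max_on_def arg_max_def)
qed

text \<open>Collects the assumptions on the model, apart from \<open>\<delta>\<close> and the number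
  of channel uses. The support shared by all parameters in \<open>\<Theta>'\<close> keeps every
  sampled outcome at positive probability at \<open>t + \<Delta>\<close> as well, so the logarithm
  never meets its default value at 0.\<close>

locale regular_model =
  fixes p :: "real^'d \<Rightarrow> 'x pmf"
    and X :: "'x set"
    and \<Theta> \<Theta>' :: "(real^'d) set"
    and r0 :: real
  assumes nonempty: "\<Theta> \<noteq> {}"
    and support: "\<And>t. t \<in> \<Theta>' \<Longrightarrow> set_pmf (p t) = X"
    and fisher_defined:
      "\<And>t. t \<in> \<Theta> \<Longrightarrow> integrable (measure_pmf (p t)) (\<lambda>x. outer_self (gradient (log_lik p x) t))"
    and score_mean:
      "\<And>t. t \<in> \<Theta> \<Longrightarrow> has_bochner_integral (measure_pmf (p t)) (\<lambda>x. gradient (log_lik p x) t) 0"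
    and hessian_mean:
      "\<And>t. t \<in> \<Theta> \<Longrightarrow>
         has_bochner_integral (measure_pmf (p t)) (\<lambda>x. hessian (log_lik p x) t) (- fisher p t)"
    and A1:
      "\<And>xs. xs \<noteq> [] \<Longrightarrow> set xs \<subseteq> X \<Longrightarrow>
         \<exists>t\<in>interior \<Theta>. {s. is_arg_max (data_log_lik p xs) (\<lambda>s. s \<in> \<Theta>) s} = {t} \<and>
           {s \<in> \<Theta>'. gradient (data_log_lik p xs) s = 0} = {t}"
    and A2: "\<And>xs. xs \<noteq> [] \<Longrightarrow> set xs \<subseteq> X \<Longrightarrow> Ck_on 3 (data_log_lik p xs) \<Theta>'"
    and R1: "open \<Theta>'" "\<Theta> \<subseteq> \<Theta>'" "0 < r0"
      "\<And>t \<Delta>. t \<in> \<Theta> \<Longrightarrow> norm \<Delta> \<le> r0 \<Longrightarrow> t + \<Delta> \<in> \<Theta>'"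
    and R2: "\<And>t. t \<in> \<Theta> \<Longrightarrow> invertible (fisher p t)"
      "(SUP t\<in>\<Theta>. ennreal (op_norm (matrix_inv (fisher p t)))) < \<infinity>"
    and R3:
      "(SUP t\<in>\<Theta>. \<integral>\<^sup>+ x. ennreal (let A = hessian (log_lik p x) t + fisher p t in trace (A ** A))
          \<partial>measure_pmf (p t)) < \<infinity>"
    and R4:
      "(SUP t\<in>\<Theta>. \<integral>\<^sup>+ x. (SUP \<Delta>\<in>cball 0 r0.
            ennreal (tensor_op_norm (third_deriv (log_lik p x) (t + \<Delta>))))\<^sup>2
          \<partial>measure_pmf (p t)) < \<infinity>"
    and R5:
      "(SUP t\<in>\<Theta>. SUP u\<in>sphere 0 1.
          (\<integral>\<^sup>+ x. ennreal (\<bar>u \<bullet> (matrix_inv (fisher p t) *v gradient (log_lik p x) t)\<bar> ^ 3)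
             \<partial>measure_pmf (p t))
          / ennreal ((u \<bullet> (matrix_inv (fisher p t) *v u)) powr (3 / 2))) < \<infinity>"
begin

abbreviation "B t \<equiv> matrix_inv (fisher p t)"
abbreviation "score t x \<equiv> gradient (log_lik p x) t"
abbreviation "dev t x \<equiv> hessian (log_lik p x) t + fisher p t"
abbreviation "third_sup t x \<equiv>
  (SUP \<Delta>\<in>cball 0 r0. ennreal (tensor_op_norm (third_deriv (log_lik p x) (t + \<Delta>))))"

lemma fisher_integral:
  "t \<in> \<Theta> \<Longrightarrow> has_bochner_integral (measure_pmf (p t)) (\<lambda>x. outer_self (score t x)) (fisher p t)"
  unfolding fisher_def by (rule has_bochner_integral_integrable[OF fisher_defined])

lemma support_Theta: "t \<in> \<Theta> \<Longrightarrow> set_pmf (p t) = X"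
  using support R1(2) by blast

lemma log_lik_C3: "x \<in> X \<Longrightarrow> Ck_on 3 (log_lik p x) \<Theta>'"
  using A2[of "[x]"] by simp

lemma log_lik_C2: "x \<in> X \<Longrightarrow> Ck_on 2 (log_lik p x) \<Theta>'"
  by (rule Ck_on_3_imp_Ck_on_2[OF log_lik_C3])

lemma log_lik_differentiable:
  assumes "x \<in> X" "s \<in> \<Theta>'"
  shows "log_lik p x differentiable (at s)" "partial_deriv i (log_lik p x) differentiable (at s)"
  using log_lik_C2[OF assms(1)] assms(2) by (auto simp: numeral_2_eq_2)

lemma dev_symmetric:
  assumes "t \<in> \<Theta>" "x \<in> X"
  shows "dev t x $ i $ j = dev t x $ j $ i"
proof -
  have "fisher p t $ i $ j = transpose (fisher p t) $ i $ j"
    by (simp only: second_moment_symmetric[OF fisher_integral[OF assms(1)]])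
  then have "fisher p t $ i $ j = fisher p t $ j $ i"
    by (simp add: transpose_def)
  moreover have "t \<in> \<Theta>'"
    using assms(1) R1(2) by blast
  then have "hessian (log_lik p x) t $ i $ j = hessian (log_lik p x) t $ j $ i"
    unfolding hessian_def vec_lambda_beta
    by (rule partial_deriv_commute[OF log_lik_C2[OF assms(2)] R1(1)])
  ultimately show ?thesis
    by simp
qed

text \<open>For a symmetric matrix \<open>trace (A ** A)\<close> is the sum of the squared entries,
  so R3 controls each entry. Symmetry of the Hessian is available at outcomes in the support, hence
  the almost-everywhere comparison.\<close>

lemma dev_entry_second_moment:
  assumes "t \<in> \<Theta>"
  shows "(\<integral>\<^sup>+x. ennreal ((dev t x $ i $ j)\<^sup>2) \<partial>measure_pmf (p t))
    \<le> (\<integral>\<^sup>+x. ennreal (let A = dev t x in trace (A ** A)) \<partial>measure_pmf (p t))"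
proof (rule nn_integral_mono_AE, rule AE_pmfI)
  fix x assume "x \<in> set_pmf (p t)"
  then have x: "x \<in> X"
    using support_Theta[OF assms] by simp
  have "trace (dev t x ** dev t x) = (\<Sum>k\<in>UNIV. \<Sum>l\<in>UNIV. (dev t x $ k $ l)\<^sup>2)"
    unfolding trace_def matrix_matrix_mult_def vec_lambda_beta power2_eq_square
    by (intro sum.cong refl arg_cong2[where f = "(*)"] dev_symmetric[OF assms x])
  moreover have "(dev t x $ i $ j)\<^sup>2 \<le> (\<Sum>l\<in>UNIV. (dev t x $ i $ l)\<^sup>2)"
    by (rule member_le_sum) auto
  moreover have "\<dots> \<le> (\<Sum>k\<in>UNIV. \<Sum>l\<in>UNIV. (dev t x $ k $ l)\<^sup>2)"
    by (rule member_le_sum[of i UNIV "\<lambda>k. \<Sum>l\<in>UNIV. (dev t x $ k $ l)\<^sup>2"]) (auto intro: sum_nonneg)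
  ultimately show "ennreal ((dev t x $ i $ j)\<^sup>2) \<le> ennreal (let A = dev t x in trace (A ** A))"
    unfolding Let_def by (intro ennreal_leI) linarith
qed

lemma dev_entry_mean:
  assumes "t \<in> \<Theta>"
  shows "has_bochner_integral (measure_pmf (p t)) (\<lambda>x. dev t x $ i $ j) 0"
proof -
  have "has_bochner_integral (measure_pmf (p t)) (\<lambda>x. fisher p t) (fisher p t)"
    by (simp add: has_bochner_integral_iff)
  from has_bochner_integral_add[OF hessian_mean[OF assms] this]
  have "has_bochner_integral (measure_pmf (p t)) (\<lambda>x. dev t x) 0"
    by simp
  from has_bochner_integral_entry[OF this, of i j] show ?thesis
    by simp
qed

text \<open>R4 bounds a second moment, whereas Markov's inequality will be applied to the
  first.\<close>

lemma third_sup_mean_le: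
  "(\<integral>\<^sup>+x. third_sup t x \<partial>measure_pmf (p t)) \<le> 1 + (\<integral>\<^sup>+x. (third_sup t x)\<^sup>2 \<partial>measure_pmf (p t))"
proof -
  have "g \<le> 1 + g\<^sup>2" for g :: ennreal
  proof (cases "g \<le> 1")
    case False
    then have "g * 1 \<le> g * g"
      by (intro mult_left_mono) auto
    then show ?thesis
      by (simp add: power2_eq_square add_increasing)
  qed (simp add: add_increasing2)
  then have "(\<integral>\<^sup>+x. third_sup t x \<partial>measure_pmf (p t))
      \<le> (\<integral>\<^sup>+x. 1 + (third_sup t x)\<^sup>2 \<partial>measure_pmf (p t))"
    by (intro nn_integral_mono)
  also have "\<dots> = 1 + (\<integral>\<^sup>+x. (third_sup t x)\<^sup>2 \<partial>measure_pmf (p t))"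
    by (simp add: nn_integral_add measure_pmf.emeasure_space_1[unfolded space_measure_pmf])
  finally show ?thesis .
qed

text \<open>Deterministic: the sample is fixed, and all that probability has to supply is
  \<open>lin\<close>, \<open>quad\<close> and \<open>cub\<close>. In \<open>small\<close>,
  \<open>a\<close> is the radius spent on the linear term and the rest pays for the
  remainder.\<close>

lemma mle_near_truth:
  fixes a b C L \<epsilon> :: real
  assumes t: "t \<in> \<Theta>" and xs: "xs \<noteq> []" "set xs \<subseteq> X"
    and \<epsilon>: "0 \<le> \<epsilon>" "\<epsilon> \<le> r0" and C: "op_norm (B t) \<le> C"
    and lin: "norm (B t *v sum_list (map (score t) xs)) \<le> a * length xs"
    and quad: "\<And>i j. \<bar>sum_list (map (\<lambda>x. dev t x $ i $ j) xs)\<bar> \<le> b * length xs"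
    and cub: "sum_list (map (third_sup t) xs) \<le> ennreal (L * length xs)"
    and L: "0 \<le> L" and fin: "\<And>x. x \<in> X \<Longrightarrow> third_sup t x < \<infinity>"
    and small: "a + C * ((real CARD('d))\<^sup>2 * b * \<epsilon> + L * \<epsilon>\<^sup>2) \<le> \<epsilon>"
  shows "norm (mle p \<Theta> xs - t) \<le> \<epsilon>"
proof -
  let ?n = "real (length xs)"
  have n: "0 < ?n"
    using xs by simp
  have t': "t \<in> \<Theta>'"
    using t R1(2) by blast
  define G where "G \<Delta> = (1 / ?n) *\<^sub>R sum_list (map (\<lambda>x. score (t + \<Delta>) x) xs)" for \<Delta>
  have in\<Theta>': "t + \<Delta> \<in> \<Theta>'" if "norm \<Delta> \<le> \<epsilon>" for \<Delta>
    using R1(4)[OF t, of \<Delta>] that \<epsilon> by simp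
  have cont: "continuous_on (cball 0 \<epsilon>) G"
  proof -
    have "continuous_on (cball 0 \<epsilon>) (\<lambda>\<Delta>. score (t + \<Delta>) x)" if "x \<in> set xs" for x
    proof -
      have "continuous_on \<Theta>' (partial_deriv i (log_lik p x))" for i
        using log_lik_differentiable(2) that xs(2)
        by (intro continuous_at_imp_continuous_on ballI differentiable_imp_continuous_within) blast
      then have "continuous_on (cball 0 \<epsilon>) (\<lambda>\<Delta>. partial_deriv i (log_lik p x) (t + \<Delta>))" for i
        by (rule continuous_on_compose2[OF _ _ image_subsetI[OF in\<Theta>']]) (auto intro!: continuous_intros)
      then show ?thesis
        unfolding gradient_def by (intro continuous_on_vec_lambda)
    qed
    then have "continuous_on (cball 0 \<epsilon>) (\<lambda>\<Delta>. sum_list (map (\<lambda>x. score (t + \<Delta>) x) ys))"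
      if "set ys \<subseteq> set xs" for ys
      using that by (induction ys) (auto intro!: continuous_intros)
    then show ?thesis
      unfolding G_def by (intro continuous_intros) simp
  qed
  have remainder: "norm (G \<Delta> - G 0 + fisher p t *v \<Delta>) \<le> (real CARD('d))\<^sup>2 * b * \<epsilon> + L * \<epsilon>\<^sup>2"
    if \<Delta>: "norm \<Delta> \<le> \<epsilon>" for \<Delta>
  proof -
    let ?r = "\<lambda>x. score (t + \<Delta>) x - score t x - hessian (log_lik p x) t *v \<Delta>"
    \<comment> \<open>The deviation from linearity splits into the Taylor remainders, governed by
      \<open>cub\<close>, and the fluctuation of the Hessian around \<open>- fisher p t\<close>,
      governed by \<open>quad\<close>.\<close>
    have "sum_list (map (\<lambda>x. score (t + \<Delta>) x) ys) - sum_list (map (\<lambda>x. score (t + 0) x) ys) + real (length ys) *\<^sub>R (fisher p t *v \<Delta>)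
      = sum_list (map ?r ys) + sum_list (map (dev t) ys) *v \<Delta>" for ys
      by (induction ys) (simp_all add: algebra_simps)
    from arg_cong[OF this[of xs], of "\<lambda>v. (1 / ?n) *\<^sub>R v"]
    have split: "G \<Delta> - G 0 + fisher p t *v \<Delta>
      = (1 / ?n) *\<^sub>R sum_list (map ?r xs) + (1 / ?n) *\<^sub>R (sum_list (map (dev t) xs) *v \<Delta>)"
      using n by (simp add: G_def algebra_simps)
    \<comment> \<open>\<open>enn2real\<close> would send an infinite supremum to 0;
      \<open>fin\<close> rules this out at every outcome occurring in \<open>xs\<close>.\<close>
    let ?g = "\<lambda>x. enn2real (third_sup t x)"
    have "norm (?r x) \<le> ?g x * \<epsilon>\<^sup>2" if x: "x \<in> set xs" for x
    proof -
      have xX: "x \<in> X"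
        using x xs(2) by blast
      have "norm (?r x) \<le> ?g x * (norm \<Delta>)\<^sup>2"
      proof (rule gradient_taylor_bound[OF log_lik_C3[OF xX] R1(1)])
        show "cball t r0 \<subseteq> \<Theta>'"
        proof
          fix s assume "s \<in> cball t r0"
          then show "s \<in> \<Theta>'"
            using R1(4)[OF t, of "s - t"] by (simp add: dist_norm norm_minus_commute)
        qed
        show "norm \<Delta> \<le> r0"
          using \<Delta> \<epsilon> by simp
        fix \<Delta>' :: "real^'d" assume "norm \<Delta>' \<le> r0"
        then have "ennreal (tensor_op_norm (third_deriv (log_lik p x) (t + \<Delta>'))) \<le> third_sup t x"
          by (intro SUP_upper) simp
        also have "\<dots> = ennreal (?g x)"
          using fin[OF xX] by (simp add: less_top)
        finally show "tensor_op_norm (third_deriv (log_lik p x) (t + \<Delta>')) \<le> ?g x"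
          by simp
      qed
      also have "\<dots> \<le> ?g x * \<epsilon>\<^sup>2"
        using \<Delta> by (intro mult_left_mono power_mono) auto
      finally show ?thesis .
    qed
    then have "norm (sum_list (map ?r xs)) \<le> sum_list (map (\<lambda>x. ?g x * \<epsilon>\<^sup>2) xs)"
      by (rule norm_sum_list_le)
    also have "\<dots> = sum_list (map ?g xs) * \<epsilon>\<^sup>2"
      by (rule sum_list_mult_const)
    also have "sum_list (map ?g xs) \<le> L * ?n"
    proof -
      have "map (third_sup t) xs = map (\<lambda>x. ennreal (?g x)) xs"
        using fin xs(2) by (auto simp: less_top)
      then have "sum_list (map (third_sup t) xs) = ennreal (sum_list (map ?g xs))"
        by (simp only: sum_list_ennreal enn2real_nonneg)
      then have "ennreal (sum_list (map ?g xs)) \<le> ennreal (L * ?n)"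
        using cub by simp
      then show ?thesis
        by (rule ennreal_le_iff[THEN iffD1, rotated]) (use L in simp)
    qed
    finally have 1: "norm (sum_list (map ?r xs)) \<le> L * ?n * \<epsilon>\<^sup>2"
      by (simp add: mult_right_mono)
    have entry: "sum_list (map (dev t) ys) $ i $ j = sum_list (map (\<lambda>x. dev t x $ i $ j) ys)" for ys i j
      by (induction ys) simp_all
    have "norm (sum_list (map (dev t) xs) *v \<Delta>) \<le> (real CARD('d))\<^sup>2 * (b * ?n) * norm \<Delta>"
      by (rule norm_matrix_vector_le_entries) (use quad in \<open>simp add: entry\<close>)
    also have "\<dots> \<le> (real CARD('d))\<^sup>2 * (b * ?n) * \<epsilon>"
      using order_trans[OF abs_ge_zero quad] \<Delta> by (intro mult_left_mono) auto
    finally have 2: "norm (sum_list (map (dev t) xs) *v \<Delta>) \<le> (real CARD('d))\<^sup>2 * (b * ?n) * \<epsilon>" .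
    have "norm (G \<Delta> - G 0 + fisher p t *v \<Delta>)
      \<le> \<bar>1 / ?n\<bar> * norm (sum_list (map ?r xs)) + \<bar>1 / ?n\<bar> * norm (sum_list (map (dev t) xs) *v \<Delta>)"
      unfolding split by (rule order_trans[OF norm_triangle_ineq]) (simp only: norm_scaleR order_refl)
    also have "\<dots> \<le> \<bar>1 / ?n\<bar> * (L * ?n * \<epsilon>\<^sup>2) + \<bar>1 / ?n\<bar> * ((real CARD('d))\<^sup>2 * (b * ?n) * \<epsilon>)"
      by (intro add_mono mult_left_mono 1 2) auto
    also have "\<dots> = (real CARD('d))\<^sup>2 * b * \<epsilon> + L * \<epsilon>\<^sup>2"
      using n by (simp add: field_simps)
    finally show ?thesis .
  qed
  note inv = matrix_inv_inverse[OF R2(1)[OF t]]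
  have "norm (B t *v G 0) = norm (B t *v sum_list (map (score t) xs)) / ?n"
    using n by (simp add: G_def matrix_vector_mult_scaleR)
  also have "\<dots> \<le> a"
    using lin n by (simp add: pos_divide_le_eq)
  finally have "norm (B t *v G 0) + C * ((real CARD('d))\<^sup>2 * b * \<epsilon> + L * \<epsilon>\<^sup>2) \<le> \<epsilon>"
    using small by linarith
  then obtain \<Delta> where \<Delta>: "norm \<Delta> \<le> \<epsilon>" "G \<Delta> = 0"
    using near_linear_map_has_zero[OF \<epsilon>(1) inv cont remainder C] by blast
  have "gradient (data_log_lik p xs) (t + \<Delta>) = sum_list (map (score (t + \<Delta>)) xs)"
    by (rule gradient_data_log_lik)
      (use log_lik_differentiable(1)[OF _ in\<Theta>'[OF \<Delta>(1)]] xs(2) in blast)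
  also have "\<dots> = 0"
    using \<Delta>(2) n by (simp add: G_def)
  \<comment> \<open>The zero is only known to lie in \<open>\<Theta>'\<close>. A1 identifies it with
    the maximizer over \<open>\<Theta>\<close> because its stationary set ranges over
    \<open>\<Theta>'\<close>.\<close>
  finally have stat: "t + \<Delta> \<in> {s \<in> \<Theta>'. gradient (data_log_lik p xs) s = 0}"
    using in\<Theta>'[OF \<Delta>(1)] by simp
  obtain t0 where t0: "{s. is_arg_max (data_log_lik p xs) (\<lambda>s. s \<in> \<Theta>) s} = {t0}"
    "{s \<in> \<Theta>'. gradient (data_log_lik p xs) s = 0} = {t0}"
    using A1[OF xs] by blast
  have "mle p \<Theta> xs = t + \<Delta>"
    using mle_eq_unique_maximizer[OF t0(1)] stat t0(2) by simp
  then show ?thesis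
    using \<Delta>(1) by simp
qed

text \<open>Dividing coordinate \<open>a\<close> of the whitened score by
  \<open>sqrt (B t $ a $ a)\<close> gives unit variance. R5 at \<open>u = axis a 1\<close> is then
  exactly a bound on the absolute third moment, so the laws for all \<open>t\<close> and
  \<open>a\<close> lie in one class and \<open>M0\<close> depends on neither.\<close>

lemma score_tail_bound:
  fixes c \<kappa> :: real
  assumes c: "0 < c" and \<kappa>: "0 < \<kappa>"
  obtains M0 :: nat where "\<And>M t a. M0 \<le> M \<Longrightarrow> t \<in> \<Theta> \<Longrightarrow>
      measure_pmf.prob (replicate_pmf M (p t))
        {xs. \<bar>(B t *v sum_list (map (score t) xs)) $ a\<bar> > c * sqrt (B t $ a $ a) * sqrt M}
      \<le> 2 * (exp (- c\<^sup>2 / 2) / (c * sqrt (2 * pi))) + \<kappa>"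
proof -
  obtain C where C: "0 < C" "\<And>t. t \<in> \<Theta> \<Longrightarrow> (SUP u\<in>sphere 0 1.
      (\<integral>\<^sup>+ x. ennreal (\<bar>u \<bullet> (B t *v score t x)\<bar> ^ 3) \<partial>measure_pmf (p t))
      / ennreal ((u \<bullet> (B t *v u)) powr (3 / 2))) \<le> ennreal C"
    using SUP_less_infinity_bound[OF R5] by blast
  obtain M0 :: nat where M0: "\<And>M q. M0 \<le> M \<Longrightarrow> integrable (measure_pmf q) (\<lambda>x. \<bar>x\<bar> ^ 3) \<Longrightarrow>
      measure_pmf.expectation q (\<lambda>x. x) = 0 \<Longrightarrow>
      measure_pmf.expectation q (\<lambda>x. x\<^sup>2) = 1 \<Longrightarrow>
      measure_pmf.expectation q (\<lambda>x. \<bar>x\<bar> ^ 3) \<le> C \<Longrightarrow>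
      measure_pmf.prob (replicate_pmf M q) {xs. \<bar>sum_list xs\<bar> > c * sqrt M}
        \<le> 2 * (exp (- c\<^sup>2 / 2) / (c * sqrt (2 * pi))) + \<kappa>"
    by (rule uniform_clt_tail_bound[OF c \<kappa>, of C]) blast
  show thesis
  proof (rule that[of M0])
    fix M t a
    assume M: "M0 \<le> M" and t: "t \<in> \<Theta>"
    let ?v = "B t $ a $ a"
    define y where "y x = (B t *v score t x) $ a / sqrt ?v" for x
    note F = fisher_integral[OF t]
    have v: "0 < ?v"
      by (rule whitened_second_moment(2)[OF F R2(1)[OF t]])
    have "has_bochner_integral (measure_pmf (p t)) (\<lambda>x. (B t *v score t x) $ a / sqrt ?v) ((B t *v 0) $ a / sqrt ?v)"
      by (intro has_bochner_integral_divide has_bochner_integral_bounded_linear[OF bounded_linear_vec_nth]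
          has_bochner_integral_bounded_linear[OF matrix_vector_mul_bounded_linear] score_mean[OF t])
    then have mean: "measure_pmf.expectation (p t) y = 0"
      by (simp add: y_def[abs_def] has_bochner_integral_iff)
    have "has_bochner_integral (measure_pmf (p t)) (\<lambda>x. ((B t *v score t x) $ a)\<^sup>2 / ?v) (?v / ?v)"
      by (intro has_bochner_integral_divide whitened_second_moment(1)[OF F R2(1)[OF t]])
    then have var: "measure_pmf.expectation (p t) (\<lambda>x. (y x)\<^sup>2) = 1"
      using v by (simp add: y_def[abs_def] has_bochner_integral_iff power_divide)
    have third: "(\<integral>\<^sup>+ x. ennreal (\<bar>y x\<bar> ^ 3) \<partial>measure_pmf (p t)) \<le> ennreal C"
    proof -
      let ?u = "axis a 1 :: real^'d"
      have inner: "?u \<bullet> w = w $ a" for w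
        by (simp add: inner_axis' )
      have quadform: "?u \<bullet> (B t *v ?u) = ?v"
        by (simp add: inner matrix_vector_mult_basis column_def)
      have "sqrt ?v ^ 3 = ?v powr (3 / 2)"
        using v by (simp add: powr_half_sqrt[symmetric] powr_powr flip: powr_realpow)
      then have "\<bar>y x\<bar> ^ 3 = \<bar>(B t *v score t x) $ a\<bar> ^ 3 / ?v powr (3 / 2)" for x
        using v by (simp add: y_def power_divide)
      then have "ennreal (\<bar>y x\<bar> ^ 3)
          = ennreal (\<bar>?u \<bullet> (B t *v score t x)\<bar> ^ 3) / ennreal ((?u \<bullet> (B t *v ?u)) powr (3 / 2))" for x
        unfolding quadform unfolding inner
        using v by (subst divide_ennreal) auto
      then have "(\<integral>\<^sup>+ x. ennreal (\<bar>y x\<bar> ^ 3) \<partial>measure_pmf (p t))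
          = (\<integral>\<^sup>+ x. ennreal (\<bar>?u \<bullet> (B t *v score t x)\<bar> ^ 3) \<partial>measure_pmf (p t))
            / ennreal ((?u \<bullet> (B t *v ?u)) powr (3 / 2))"
        by (simp add: nn_integral_divide)
      also have "\<dots> \<le> ennreal C"
        by (rule order_trans[OF SUP_upper C(2)[OF t]]) (simp add: norm_axis_1)
      finally show ?thesis .
    qed
    have int3: "integrable (measure_pmf (p t)) (\<lambda>x. \<bar>y x\<bar> ^ 3)"
      by (rule integrableI_bounded) (use third in \<open>auto simp: power_abs le_less_trans\<close>)
    have "ennreal (measure_pmf.expectation (p t) (\<lambda>x. \<bar>y x\<bar> ^ 3)) \<le> ennreal C"
      using third by (subst nn_integral_eq_integral[OF int3, symmetric]) auto
    then have le3: "measure_pmf.expectation (p t) (\<lambda>x. \<bar>y x\<bar> ^ 3) \<le> C"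
      using C(1) by simp
    let ?q = "map_pmf y (p t)"
    have "measure_pmf.prob (replicate_pmf M ?q) {xs. \<bar>sum_list xs\<bar> > c * sqrt M}
        \<le> 2 * (exp (- c\<^sup>2 / 2) / (c * sqrt (2 * pi))) + \<kappa>"
      by (rule M0[OF M]) (use int3 mean var le3 in \<open>simp_all add: integrable_map_pmf_eq\<close>)
    moreover have "measure_pmf.prob (replicate_pmf M ?q) {xs. \<bar>sum_list xs\<bar> > c * sqrt M}
      = measure_pmf.prob (replicate_pmf M (p t))
        {xs. \<bar>(B t *v sum_list (map (score t) xs)) $ a\<bar> > c * sqrt ?v * sqrt M}"
    proof -
      have sum: "sum_list (map y xs) = (B t *v sum_list (map (score t) xs)) $ a / sqrt ?v" for xs
        by (induction xs) (simp_all add: y_def matrix_vector_right_distrib add_divide_distrib)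
      have "c * sqrt M < \<bar>z / sqrt ?v\<bar> \<longleftrightarrow> c * sqrt ?v * sqrt M < \<bar>z\<bar>" for z
        using v by (simp add: field_simps)
      then show ?thesis
        by (simp add: map_replicate_pmf vimage_def sum)
    qed
    ultimately show "measure_pmf.prob (replicate_pmf M (p t))
        {xs. \<bar>(B t *v sum_list (map (score t) xs)) $ a\<bar> > c * sqrt ?v * sqrt M}
      \<le> 2 * (exp (- c\<^sup>2 / 2) / (c * sqrt (2 * pi))) + \<kappa>"
      by simp
  qed
qed

end

section \<open>From guarantees with slack to the limit superior\<close>

lemma asymp_le_min_repetitionsI:
  assumes K: "0 < K"
    and guarantee: "\<And>\<eta>. 0 < \<eta> \<Longrightarrow> \<eta> < 1 \<Longrightarrow> \<exists>M1 \<epsilon>1. 0 < \<epsilon>1 \<and>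
      (\<forall>\<epsilon> M. 0 < \<epsilon> \<longrightarrow> \<epsilon> < \<epsilon>1 \<longrightarrow> M1 \<le> M \<longrightarrow> K / ((1 - \<eta>)\<^sup>2 * \<epsilon>\<^sup>2) \<le> real M \<longrightarrow> mle_guarantee p \<Theta> \<delta> \<epsilon> M)"
  shows "asymp_le (min_repetitions p \<Theta> \<delta>) (\<lambda>\<epsilon>. K / \<epsilon>\<^sup>2)"
  unfolding asymp_le_def
proof (rule ereal_le_epsilon2)
  fix e :: real assume e: "0 < e"
  \<comment> \<open>Solves \<open>1 / (1 - \<eta>)\<^sup>2 = 1 + e / 2\<close>; the other half of
    \<open>e\<close> absorbs additive constants.\<close>
  define \<eta> where "\<eta> = 1 - 1 / sqrt (1 + e / 2)"
  have \<eta>: "0 < \<eta>" "\<eta> < 1"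
    using e by (auto simp: \<eta>_def)
  have sq: "(1 - \<eta>)\<^sup>2 = 1 / (1 + e / 2)"
    using e by (simp add: \<eta>_def power_divide)
  obtain M1 \<epsilon>1 where \<epsilon>1: "0 < \<epsilon>1" and M1: "\<And>\<epsilon> M. 0 < \<epsilon> \<Longrightarrow> \<epsilon> < \<epsilon>1 \<Longrightarrow> M1 \<le> M \<Longrightarrow>
      K / ((1 - \<eta>)\<^sup>2 * \<epsilon>\<^sup>2) \<le> real M \<Longrightarrow> mle_guarantee p \<Theta> \<delta> \<epsilon> M"
    using guarantee[OF \<eta>] by blast
  \<comment> \<open>Below \<open>\<epsilon>2\<close> the constant \<open>M1 + 2\<close> is at most
    \<open>e / 2 * (K / \<epsilon>\<^sup>2)\<close>. The 2 pays for the summand 1 in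
    \<open>M0\<close> and for rounding up.\<close>
  define \<epsilon>2 where "\<epsilon>2 = sqrt (e / 2 * K / (real M1 + 2))"
  have \<epsilon>2: "0 < \<epsilon>2" "\<epsilon>2\<^sup>2 = e / 2 * K / (real M1 + 2)"
    using e K by (auto simp: \<epsilon>2_def)
  have "ereal_of_enat (min_repetitions p \<Theta> \<delta> \<epsilon>) / ereal (K / \<epsilon>\<^sup>2) \<le> ereal (1 + e)"
    if \<epsilon>: "0 < \<epsilon>" "\<epsilon> < min \<epsilon>1 \<epsilon>2" for \<epsilon>
  proof -
    \<comment> \<open>The summand 1 secures \<open>1 \<le> M0\<close>, which
      \<open>min_repetitions\<close> demands of a threshold.\<close>
    define M0 where "M0 = M1 + 1 + nat \<lceil>(1 + e / 2) * (K / \<epsilon>\<^sup>2)\<rceil>"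
    have b: "0 < K / \<epsilon>\<^sup>2"
      using K \<epsilon> by simp
    have "mle_guarantee p \<Theta> \<delta> \<epsilon> M" if "M0 \<le> M" for M
    proof (rule M1)
      have "K / ((1 - \<eta>)\<^sup>2 * \<epsilon>\<^sup>2) = (1 + e / 2) * (K / \<epsilon>\<^sup>2)"
        by (simp add: sq)
      also have "\<dots> \<le> real M0"
        unfolding M0_def by linarith
      also have "\<dots> \<le> real M"
        using that by simp
      finally show "K / ((1 - \<eta>)\<^sup>2 * \<epsilon>\<^sup>2) \<le> real M" .
    qed (use \<epsilon> that in \<open>auto simp: M0_def\<close>)
    then have "min_repetitions p \<Theta> \<delta> \<epsilon> \<le> enat M0"
      unfolding min_repetitions_def by (intro INF_lower) (simp add: M0_def)
    then have "ereal_of_enat (min_repetitions p \<Theta> \<delta> \<epsilon>) \<le> ereal_of_enat (enat M0)"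
      by (simp only: ereal_of_enat_le_iff)
    then have "ereal_of_enat (min_repetitions p \<Theta> \<delta> \<epsilon>) / ereal (K / \<epsilon>\<^sup>2) \<le> ereal (real M0) / ereal (K / \<epsilon>\<^sup>2)"
      using b by (intro ereal_divide_right_mono) auto
    also have "\<dots> = ereal (real M0 / (K / \<epsilon>\<^sup>2))"
      using K \<epsilon> by simp
    also have "real M0 / (K / \<epsilon>\<^sup>2) \<le> 1 + e"
    proof -
      have "\<epsilon>\<^sup>2 \<le> \<epsilon>2\<^sup>2"
        using \<epsilon> by (intro power_mono) auto
      then have "(real M1 + 2) * \<epsilon>\<^sup>2 \<le> e / 2 * K"
        unfolding \<epsilon>2(2) by (simp add: pos_le_divide_eq algebra_simps)
      then have "real M1 + 2 \<le> e / 2 * (K / \<epsilon>\<^sup>2)"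
        using \<epsilon> by (simp add: pos_le_divide_eq)
      moreover have "real M0 \<le> real M1 + 2 + (1 + e / 2) * (K / \<epsilon>\<^sup>2)"
      proof -
        have "0 \<le> (1 + e / 2) * (K / \<epsilon>\<^sup>2)"
          using e b by (intro mult_nonneg_nonneg) auto
        then show ?thesis
          unfolding M0_def by linarith
      qed
      moreover have "(1 + e) * (K / \<epsilon>\<^sup>2) = e / 2 * (K / \<epsilon>\<^sup>2) + (1 + e / 2) * (K / \<epsilon>\<^sup>2)"
        by (simp only: distrib_right[symmetric]) simp
      ultimately have "real M0 \<le> (1 + e) * (K / \<epsilon>\<^sup>2)"
        by linarith
      then show ?thesis
        using b by (simp only: pos_divide_le_eq)
    qed
    finally show ?thesis
      by simp
  qed
  then have "\<forall>\<^sub>F \<epsilon> in at_right 0. ereal_of_enat (min_repetitions p \<Theta> \<delta> \<epsilon>) / ereal (K / \<epsilon>\<^sup>2) \<le> ereal (1 + e)"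
    unfolding eventually_at_right_field using \<epsilon>1 \<epsilon>2(1) by (intro exI[of _ "min \<epsilon>1 \<epsilon>2"]) auto
  from Limsup_bounded[OF this]
  show "Limsup (at_right 0) (\<lambda>\<epsilon>. ereal_of_enat (min_repetitions p \<Theta> \<delta> \<epsilon>) / ereal (K / \<epsilon>\<^sup>2)) \<le> 1 + ereal e"
    by (simp add: add.commute)
qed

text \<open>The factor \<open>N\<close> cancels in the quotient even where \<open>A\<close> is
  infinite: a positive \<open>N\<close> keeps the product infinite.\<close>

lemma asymp_le_scale:
  assumes A: "asymp_le A B" and N: "1 \<le> N" and B: "\<And>\<epsilon>. 0 < \<epsilon> \<Longrightarrow> 0 < B \<epsilon>"
  shows "asymp_le (\<lambda>\<epsilon>. enat N * A \<epsilon>) (\<lambda>\<epsilon>. real N * B \<epsilon>)"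
proof -
  have "ereal_of_enat (enat N * A \<epsilon>) / ereal (real N * B \<epsilon>) = ereal_of_enat (A \<epsilon>) / ereal (B \<epsilon>)"
    if "0 < \<epsilon>" for \<epsilon>
    using B[OF that] N by (cases "A \<epsilon>") (auto simp: imult_is_infinity)
  then have "\<forall>\<^sub>F \<epsilon> in at_right 0. ereal_of_enat (enat N * A \<epsilon>) / ereal (real N * B \<epsilon>)
      = ereal_of_enat (A \<epsilon>) / ereal (B \<epsilon>)"
    by (intro eventually_at_right_less[THEN eventually_mono])
  from Limsup_eq[OF this] A show ?thesis
    by (simp add: asymp_le_def)
qed

section \<open>Failure probability and the choice of constants\<close>

context regular_model
begin

lemma op_norm_inv_bound:
  obtains C where "0 < C" "\<And>t. t \<in> \<Theta> \<Longrightarrow> op_norm (B t) \<le> C"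
proof -
  obtain C where C: "0 < C" "\<And>t. t \<in> \<Theta> \<Longrightarrow> ennreal (op_norm (B t)) \<le> ennreal C"
    using SUP_less_infinity_bound[OF R2(2)] by blast
  then show thesis
    using that[of C] by simp
qed

text \<open>The supremum is taken in the reals, so boundedness must be shown first; R2 provides it,
  since the operator norm dominates the diagonal entries.\<close>

lemma diagonal_le_SUP:
  assumes "t \<in> \<Theta>"
  shows "B t $ a $ a \<le> (SUP t\<in>\<Theta>. MAX a. B t $ a $ a)"
proof -
  obtain C where C: "\<And>t. t \<in> \<Theta> \<Longrightarrow> op_norm (B t) \<le> C"
    by (rule op_norm_inv_bound) blast
  have "bdd_above ((\<lambda>t. MAX a. B t $ a $ a) ` \<Theta>)"
  proof (rule bdd_aboveI2)
    fix t assume "t \<in> \<Theta>"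
    then show "(MAX a. B t $ a $ a) \<le> C"
      using order_trans[OF diagonal_le_op_norm C] by simp
  qed
  then have "(MAX a. B t $ a $ a) \<le> (SUP t\<in>\<Theta>. MAX a. B t $ a $ a)"
    using assms by (rule cSUP_upper[rotated])
  moreover have "B t $ a $ a \<le> (MAX a. B t $ a $ a)"
    by (rule Max_ge) auto
  ultimately show ?thesis
    by linarith
qed

lemma SUP_diagonal_pos: "0 < (SUP t\<in>\<Theta>. MAX a. B t $ a $ a)"
proof -
  obtain t where t: "t \<in> \<Theta>"
    using nonempty by blast
  show ?thesis
    by (rule less_le_trans[OF whitened_second_moment(2)[OF fisher_integral[OF t] R2(1)[OF t]] diagonal_le_SUP[OF t]])
qed

text \<open>A union bound with one event per coordinate of the score, one per entry of the Hessian
  and one for the third derivatives. Outside these events the deterministic estimate applies, but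
  only to samples drawn from the support, so the inclusion of events holds almost surely.\<close>

lemma mle_failure_prob_le:
  fixes s b L C C3 C4 c \<epsilon> \<alpha> :: real
  assumes t: "t \<in> \<Theta>" and M: "0 < M"
    and \<epsilon>: "0 \<le> \<epsilon>" "\<epsilon> \<le> r0" and C: "op_norm (B t) \<le> C"
    and score_tail: "\<And>a. measure_pmf.prob (replicate_pmf M (p t))
        {xs. \<bar>(B t *v sum_list (map (score t) xs)) $ a\<bar> > c * sqrt (B t $ a $ a) * sqrt M} \<le> s"
    and c: "\<And>a. sqrt (real CARD('d)) * (c * sqrt (B t $ a $ a) * sqrt M) \<le> \<alpha> * M"
    and C3: "0 \<le> C3" "(\<integral>\<^sup>+x. ennreal (let A = dev t x in trace (A ** A)) \<partial>measure_pmf (p t)) \<le> ennreal C3"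
    and C4: "0 \<le> C4" "(\<integral>\<^sup>+x. third_sup t x \<partial>measure_pmf (p t)) \<le> ennreal C4"
    and b: "0 < b" and L: "0 < L"
    and small: "\<alpha> + C * ((real CARD('d))\<^sup>2 * b * \<epsilon> + L * \<epsilon>\<^sup>2) \<le> \<epsilon>"
  shows "measure_pmf.prob (replicate_pmf M (p t)) {xs. \<not> norm (mle p \<Theta> xs - t) \<le> \<epsilon>}
    \<le> real CARD('d) * s + (real CARD('d))\<^sup>2 * (C3 / (b\<^sup>2 * M)) + C4 / L"
proof -
  let ?R = "replicate_pmf M (p t)"
  define S1 where "S1 a = {xs. \<bar>(B t *v sum_list (map (score t) xs)) $ a\<bar> > c * sqrt (B t $ a $ a) * sqrt M}" for a
  define S2 where "S2 ij = {xs. \<bar>sum_list (map (\<lambda>x. dev t x $ fst ij $ snd ij) xs)\<bar> > b * M}" for ij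
  define S3 where "S3 = {xs. sum_list (map (third_sup t) xs) > ennreal (L * M)}"
  \<comment> \<open>A finite mean gives finiteness almost everywhere, and each point of the support
    carries positive mass, so this means at every point of \<open>X\<close>.\<close>
  have "(\<integral>\<^sup>+x. third_sup t x \<partial>measure_pmf (p t)) \<noteq> \<infinity>"
    using C4(2) by (auto simp: top_unique)
  then have "AE x in measure_pmf (p t). third_sup t x \<noteq> \<infinity>"
    by (intro nn_integral_noteq_infinite) auto
  then have fin: "third_sup t x < \<infinity>" if "x \<in> X" for x
    using that support_Theta[OF t] unfolding AE_measure_pmf_iff infinity_ennreal_def less_top[symmetric] by blast
  have "AE xs in ?R. xs \<in> {xs. \<not> norm (mle p \<Theta> xs - t) \<le> \<epsilon>} \<longrightarrow> xs \<in> (\<Union>a. S1 a) \<union> (\<Union>ij. S2 ij) \<union> S3"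
  proof (rule AE_pmfI, rule impI, rule ccontr)
    fix xs
    assume xs: "xs \<in> set_pmf ?R" and far: "xs \<in> {xs. \<not> norm (mle p \<Theta> xs - t) \<le> \<epsilon>}"
      and good: "xs \<notin> (\<Union>a. S1 a) \<union> (\<Union>ij. S2 ij) \<union> S3"
    have len: "length xs = M" and sub: "set xs \<subseteq> X"
      using xs support_Theta[OF t] by (auto simp: set_replicate_pmf)
    have "\<bar>(B t *v sum_list (map (score t) xs)) $ i\<bar> \<le> \<alpha> * M / sqrt (real CARD('d))" for i
    proof -
      have "\<bar>(B t *v sum_list (map (score t) xs)) $ i\<bar> \<le> c * sqrt (B t $ i $ i) * sqrt M"
        using good by (auto simp: S1_def not_less)
      also have "\<dots> \<le> \<alpha> * M / sqrt (real CARD('d))"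
        using c[of i] by (simp add: pos_le_divide_eq mult_ac)
      finally show ?thesis .
    qed
    then have "norm (B t *v sum_list (map (score t) xs)) \<le> sqrt (real CARD('d)) * (\<alpha> * M / sqrt (real CARD('d)))"
      by (rule norm_le_sqrt_card)
    then have "norm (B t *v sum_list (map (score t) xs)) \<le> \<alpha> * length xs"
      by (simp add: len)
    moreover have "\<bar>sum_list (map (\<lambda>x. dev t x $ i $ j) xs)\<bar> \<le> b * length xs" for i j
      using good by (auto simp: S2_def len not_less dest: spec[of _ i])
    moreover have "sum_list (map (third_sup t) xs) \<le> ennreal (L * length xs)"
      using good by (auto simp: S3_def len not_less)
    ultimately have "norm (mle p \<Theta> xs - t) \<le> \<epsilon>"
      using len M L by (intro mle_near_truth[OF t _ sub \<epsilon> C _ _ _ _ fin small]) auto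
    then show False
      using far by simp
  qed
  then have "measure_pmf.prob ?R {xs. \<not> norm (mle p \<Theta> xs - t) \<le> \<epsilon>}
      \<le> measure_pmf.prob ?R ((\<Union>a. S1 a) \<union> (\<Union>ij. S2 ij) \<union> S3)"
    by (intro measure_pmf.finite_measure_mono_AE) auto
  also have "\<dots> \<le> measure_pmf.prob ?R (\<Union>a. S1 a) + measure_pmf.prob ?R (\<Union>ij. S2 ij) + measure_pmf.prob ?R S3"
    by (intro order_trans[OF measure_Un_le] add_right_mono measure_Un_le) auto
  also have "measure_pmf.prob ?R (\<Union>a. S1 a) \<le> (\<Sum>a\<in>UNIV. measure_pmf.prob ?R (S1 a))"
    by (rule measure_UNION_le) auto
  also have "\<dots> \<le> (\<Sum>a\<in>(UNIV::'d set). s)"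
    unfolding S1_def by (intro sum_mono score_tail)
  also have "measure_pmf.prob ?R (\<Union>ij. S2 ij) \<le> (\<Sum>ij\<in>UNIV. measure_pmf.prob ?R (S2 ij))"
    by (rule measure_UNION_le) auto
  also have "\<dots> \<le> (\<Sum>ij\<in>(UNIV::('d \<times> 'd) set). C3 / (b\<^sup>2 * M))"
    unfolding S2_def
    using dev_entry_mean[OF t] order_trans[OF dev_entry_second_moment[OF t] C3(2)]
    by (intro sum_mono replicate_pmf_chebyshev b M C3(1)) (auto simp: has_bochner_integral_iff)
  also have "measure_pmf.prob ?R S3 \<le> C4 / L"
    unfolding S3_def by (rule replicate_pmf_markov[OF C4(2) L M C4(1)])
  finally show ?thesis
    by (simp add: card_cartesian_product power2_eq_square flip: UNIV_Times_UNIV)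
qed

text \<open>The order of choices matters: \<open>b\<close> and \<open>L\<close> depend on
  \<open>\<delta>\<close>, \<open>\<eta>\<close> and the model bounds only, after which
  \<open>M1\<close> and \<open>\<epsilon>1\<close> are fixed. None of them involves \<open>t\<close>
  or \<open>\<epsilon>\<close>.\<close>

lemma mle_guarantee_if_many_repetitions:
  fixes \<delta> \<eta> :: real
  assumes \<delta>: "0 < \<delta>" and \<eta>: "0 < \<eta>" "\<eta> < 1"
  defines "W \<equiv> Lambert_W0 (8 / (pi * \<delta>\<^sup>2) * (real CARD('d))\<^sup>2)"
    and "V \<equiv> (SUP t\<in>\<Theta>. MAX a. B t $ a $ a)"
  shows "\<exists>M1 \<epsilon>1. 0 < \<epsilon>1 \<and> (\<forall>\<epsilon> M. 0 < \<epsilon> \<longrightarrow> \<epsilon> < \<epsilon>1 \<longrightarrow> M1 \<le> M \<longrightarrow>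
      real CARD('d) * W * V / ((1 - \<eta>)\<^sup>2 * \<epsilon>\<^sup>2) \<le> real M \<longrightarrow> mle_guarantee p \<Theta> \<delta> \<epsilon> M)"
proof -
  let ?d = "real CARD('d)"
  have d: "0 < ?d"
    by simp
  have W: "0 < W"
    unfolding W_def using \<delta> by (intro Lambert_W0_pos) simp
  have V: "0 < V"
    unfolding V_def by (rule SUP_diagonal_pos)
  obtain C where C: "0 < C" "\<And>t. t \<in> \<Theta> \<Longrightarrow> op_norm (B t) \<le> C"
    by (rule op_norm_inv_bound) blast
  obtain C3 where C3: "0 < C3" "\<And>t. t \<in> \<Theta> \<Longrightarrow>
      (\<integral>\<^sup>+x. ennreal (let A = dev t x in trace (A ** A)) \<partial>measure_pmf (p t)) \<le> ennreal C3"
    using SUP_less_infinity_bound[OF R3] by blast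
  obtain C4' where C4': "0 < C4'" "\<And>t. t \<in> \<Theta> \<Longrightarrow>
      (\<integral>\<^sup>+x. (third_sup t x)\<^sup>2 \<partial>measure_pmf (p t)) \<le> ennreal C4'"
    using SUP_less_infinity_bound[OF R4] by blast
  define C4 where "C4 = 1 + C4'"
  have C4: "0 < C4" "(\<integral>\<^sup>+x. third_sup t x \<partial>measure_pmf (p t)) \<le> ennreal C4" if "t \<in> \<Theta>" for t
  proof -
    have "(\<integral>\<^sup>+x. third_sup t x \<partial>measure_pmf (p t)) \<le> 1 + ennreal C4'"
      by (rule order_trans[OF third_sup_mean_le add_left_mono[OF C4'(2)[OF that]]])
    then show "(\<integral>\<^sup>+x. third_sup t x \<partial>measure_pmf (p t)) \<le> ennreal C4"
      using C4'(1) by (simp add: C4_def)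
  qed (use C4'(1) in \<open>simp add: C4_def\<close>)
  \<comment> \<open>The half of \<open>\<delta>\<close> left over by the Gaussian tails is cut into
    three shares of \<open>\<delta> / 6\<close>: the limit-theorem error \<open>\<kappa>\<close>
    summed over the coordinates, the Hessian through \<open>M1\<close>, and the third derivatives
    through \<open>L\<close>. The reserve \<open>\<eta> * \<epsilon>\<close> of the radius is
    halved: \<open>b\<close> makes the Hessian term equal to one half, and
    \<open>\<epsilon>1\<close> keeps the cubic term within the other.\<close>
  define \<kappa> where "\<kappa> = \<delta> / (6 * ?d)"
  define b where "b = \<eta> / (2 * C * ?d\<^sup>2)"
  define L where "L = 6 * C4 / \<delta>"
  have C4_pos: "0 < C4"
    using C4'(1) by (simp add: C4_def)
  have pos: "0 < \<kappa>" "0 < b" "0 < L"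
    using \<delta> \<eta> C(1) C4_pos by (auto simp: \<kappa>_def b_def L_def)
  obtain M0 :: nat where M0: "\<And>M t a. M0 \<le> M \<Longrightarrow> t \<in> \<Theta> \<Longrightarrow>
      measure_pmf.prob (replicate_pmf M (p t))
        {xs. \<bar>(B t *v sum_list (map (score t) xs)) $ a\<bar> > sqrt W * sqrt (B t $ a $ a) * sqrt M}
      \<le> 2 * (exp (- (sqrt W)\<^sup>2 / 2) / (sqrt W * sqrt (2 * pi))) + \<kappa>"
    by (rule score_tail_bound[of "sqrt W" \<kappa>]) (use W pos in auto)
  \<comment> \<open>The second entry brings the Chebyshev bound for all Hessian entries below
    \<open>\<delta> / 6\<close>; its summand 1 keeps \<open>M\<close> positive.\<close>
  define M1 where "M1 = max M0 (nat \<lceil>6 * ?d\<^sup>2 * C3 / (b\<^sup>2 * \<delta>)\<rceil> + 1)"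
  define \<epsilon>1 where "\<epsilon>1 = min r0 (\<eta> / (2 * C * L))"
  have "0 < \<epsilon>1"
    using R1(3) \<eta> C(1) pos by (simp add: \<epsilon>1_def)
  moreover have "mle_guarantee p \<Theta> \<delta> \<epsilon> M"
    if \<epsilon>: "0 < \<epsilon>" "\<epsilon> < \<epsilon>1" and M: "M1 \<le> M" "?d * W * V / ((1 - \<eta>)\<^sup>2 * \<epsilon>\<^sup>2) \<le> real M" for \<epsilon> M
    unfolding mle_guarantee_def
  proof
    fix t assume t: "t \<in> \<Theta>"
    have Mpos: "0 < M" "M0 \<le> M"
      using M(1) by (auto simp: M1_def)
    have small: "(1 - \<eta>) * \<epsilon> + C * (?d\<^sup>2 * b * \<epsilon> + L * \<epsilon>\<^sup>2) \<le> \<epsilon>"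
    proof -
      have "C * (?d\<^sup>2 * b * \<epsilon>) = \<eta> / 2 * \<epsilon>"
        using C(1) by (simp add: b_def)
      moreover have "C * L * \<epsilon> \<le> \<eta> / 2"
        using \<epsilon> C(1) pos by (simp add: \<epsilon>1_def field_simps)
      then have "C * L * \<epsilon> * \<epsilon> \<le> \<eta> / 2 * \<epsilon>"
        using \<epsilon> by (intro mult_right_mono) auto
      moreover have "C * (?d\<^sup>2 * b * \<epsilon> + L * \<epsilon>\<^sup>2) = C * (?d\<^sup>2 * b * \<epsilon>) + C * L * \<epsilon> * \<epsilon>"
        by (simp add: algebra_simps power2_eq_square)
      ultimately show ?thesis
        by (simp only: left_diff_distrib)
    qed
    have radius: "sqrt ?d * (sqrt W * sqrt (B t $ a $ a) * sqrt M) \<le> (1 - \<eta>) * \<epsilon> * M" for a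
    proof -
      \<comment> \<open>The lower bound on \<open>M\<close>, solved for the radius: this is where
        the constant of the theorem is used up, with \<open>V\<close> standing in for the variance
        of every coordinate at every \<open>t\<close>.\<close>
      have "?d * W * V \<le> M * ((1 - \<eta>) * \<epsilon>)\<^sup>2"
        using M(2) \<epsilon> \<eta> by (simp add: pos_divide_le_eq power_mult_distrib)
      then have "sqrt (?d * W * V) \<le> sqrt (M * ((1 - \<eta>) * \<epsilon>)\<^sup>2)"
        by simp
      then have "sqrt ?d * sqrt W * sqrt V \<le> sqrt M * ((1 - \<eta>) * \<epsilon>)"
        using \<epsilon> \<eta> by (simp add: real_sqrt_mult)
      then have "sqrt ?d * sqrt W * sqrt V * sqrt M \<le> sqrt M * ((1 - \<eta>) * \<epsilon>) * sqrt M"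
        by (rule mult_right_mono) simp
      also have "\<dots> = (1 - \<eta>) * \<epsilon> * M"
        by simp
      moreover have "sqrt ?d * sqrt W * sqrt (B t $ a $ a) * sqrt M \<le> sqrt ?d * sqrt W * sqrt V * sqrt M"
        using diagonal_le_SUP[OF t, of a] W
        by (intro mult_right_mono mult_left_mono) (auto simp: V_def)
      ultimately show ?thesis
        by (simp add: mult_ac)
    qed
    have "measure_pmf.prob (replicate_pmf M (p t)) {xs. \<not> norm (mle p \<Theta> xs - t) \<le> \<epsilon>}
      \<le> ?d * (2 * (exp (- (sqrt W)\<^sup>2 / 2) / (sqrt W * sqrt (2 * pi))) + \<kappa>) + ?d\<^sup>2 * (C3 / (b\<^sup>2 * M)) + C4 / L"
      by (rule mle_failure_prob_le[OF t Mpos(1) _ _ C(2)[OF t] M0[OF Mpos(2) t] radius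
            _ C3(2)[OF t] _ C4(2)[OF t] pos(2,3) small])
        (use \<epsilon> W C3 C4_pos in \<open>auto simp: \<epsilon>1_def\<close>)
    also have "\<dots> \<le> \<delta>"
    proof -
      have "?d * (2 * (exp (- (sqrt W)\<^sup>2 / 2) / (sqrt W * sqrt (2 * pi))) + \<kappa>) = \<delta> / 2 + \<delta> / 6"
        unfolding W_def gaussian_tail_Lambert_W0[OF \<delta> d] \<kappa>_def by (simp add: field_simps)
      moreover have "C4 / L = \<delta> / 6"
        using C4_pos \<delta> by (simp add: L_def)
      moreover have "?d\<^sup>2 * (C3 / (b\<^sup>2 * M)) \<le> \<delta> / 6"
      proof -
        have "6 * ?d\<^sup>2 * C3 / (b\<^sup>2 * \<delta>) \<le> M"
          using M(1) unfolding M1_def by linarith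
        then show ?thesis
          using \<delta> pos(2) Mpos(1) by (simp add: field_simps)
      qed
      ultimately show ?thesis
        by linarith
    qed
    finally have "measure_pmf.prob (replicate_pmf M (p t)) (UNIV - {xs. norm (mle p \<Theta> xs - t) \<le> \<epsilon>}) \<le> \<delta>"
      by (simp add: Collect_neg_eq Compl_eq_Diff_UNIV)
    then show "measure_pmf.prob (replicate_pmf M (p t)) {xs. norm (mle p \<Theta> xs - t) \<le> \<epsilon>} \<ge> 1 - \<delta>"
      using measure_pmf.prob_compl[of "{xs. norm (mle p \<Theta> xs - t) \<le> \<epsilon>}" "replicate_pmf M (p t)"]
      by simp
  qed
  ultimately show ?thesis
    by blast
qed

end

theorem theorem3:
  fixes p :: "real^'d \<Rightarrow> 'x pmf"
    and X :: "'x set"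
    and \<Theta> \<Theta>' :: "(real^'d) set"
    and r0 \<delta> :: real
    and N_E :: nat
  assumes nonempty: "\<Theta> \<noteq> {}"
    and support: "\<And>t. t \<in> \<Theta>' \<Longrightarrow> set_pmf (p t) = X"
    and fisher_defined:
      "\<And>t. t \<in> \<Theta> \<Longrightarrow> integrable (measure_pmf (p t)) (\<lambda>x. outer_self (gradient (log_lik p x) t))"
    and score_mean:
      "\<And>t. t \<in> \<Theta> \<Longrightarrow> has_bochner_integral (measure_pmf (p t)) (\<lambda>x. gradient (log_lik p x) t) 0"
    and hessian_mean:
      "\<And>t. t \<in> \<Theta> \<Longrightarrow>
         has_bochner_integral (measure_pmf (p t)) (\<lambda>x. hessian (log_lik p x) t) (- fisher p t)"
    and A1:
      "\<And>xs. xs \<noteq> [] \<Longrightarrow> set xs \<subseteq> X \<Longrightarrow>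
         \<exists>t\<in>interior \<Theta>. {s. is_arg_max (data_log_lik p xs) (\<lambda>s. s \<in> \<Theta>) s} = {t} \<and>
           {s \<in> \<Theta>'. gradient (data_log_lik p xs) s = 0} = {t}"
    and A2: "\<And>xs. xs \<noteq> [] \<Longrightarrow> set xs \<subseteq> X \<Longrightarrow> Ck_on 3 (data_log_lik p xs) \<Theta>'"
    and R1: "open \<Theta>'" "\<Theta> \<subseteq> \<Theta>'" "0 < r0"
      "\<And>t \<Delta>. t \<in> \<Theta> \<Longrightarrow> norm \<Delta> \<le> r0 \<Longrightarrow> t + \<Delta> \<in> \<Theta>'"
    and R2: "\<And>t. t \<in> \<Theta> \<Longrightarrow> invertible (fisher p t)"
      "(SUP t\<in>\<Theta>. ennreal (op_norm (matrix_inv (fisher p t)))) < \<infinity>"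
    and R3:
      "(SUP t\<in>\<Theta>. \<integral>\<^sup>+ x. ennreal (let A = hessian (log_lik p x) t + fisher p t in trace (A ** A))
          \<partial>measure_pmf (p t)) < \<infinity>"
    and R4:
      "(SUP t\<in>\<Theta>. \<integral>\<^sup>+ x. (SUP \<Delta>\<in>cball 0 r0.
            ennreal (tensor_op_norm (third_deriv (log_lik p x) (t + \<Delta>))))\<^sup>2
          \<partial>measure_pmf (p t)) < \<infinity>"
    and R5:
      "(SUP t\<in>\<Theta>. SUP u\<in>sphere 0 1.
          (\<integral>\<^sup>+ x. ennreal (\<bar>u \<bullet> (matrix_inv (fisher p t) *v gradient (log_lik p x) t)\<bar> ^ 3)
             \<partial>measure_pmf (p t))
          / ennreal ((u \<bullet> (matrix_inv (fisher p t) *v u)) powr (3 / 2))) < \<infinity>"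
    and \<delta>: "0 < \<delta>" "\<delta> \<le> 1"
    and N_E: "1 \<le> N_E"
  shows
    "asymp_le (min_repetitions p \<Theta> \<delta>)
       (\<lambda>\<epsilon>. real CARD('d) * Lambert_W0 (8 / (pi * \<delta>\<^sup>2) * (real CARD('d))\<^sup>2)
          * (SUP t\<in>\<Theta>. MAX a. matrix_inv (fisher p t) $ a $ a) / \<epsilon>\<^sup>2)
     \<and> asymp_le (min_samples N_E p \<Theta> \<delta>)
       (\<lambda>\<epsilon>. real N_E * real CARD('d) * Lambert_W0 (8 / (pi * \<delta>\<^sup>2) * (real CARD('d))\<^sup>2)
          * (SUP t\<in>\<Theta>. MAX a. matrix_inv (fisher p t) $ a $ a) / \<epsilon>\<^sup>2)"
proof -
  interpret regular_model p X \<Theta> \<Theta>' r0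
    by (rule regular_model.intro) fact+
  define K where "K = real CARD('d) * Lambert_W0 (8 / (pi * \<delta>\<^sup>2) * (real CARD('d))\<^sup>2)
      * (SUP t\<in>\<Theta>. MAX a. matrix_inv (fisher p t) $ a $ a)"
  have "0 < Lambert_W0 (8 / (pi * \<delta>\<^sup>2) * (real CARD('d))\<^sup>2)"
    using \<delta> by (intro Lambert_W0_pos) simp
  then have K: "0 < K"
    using SUP_diagonal_pos by (simp add: K_def)
  have "asymp_le (min_repetitions p \<Theta> \<delta>) (\<lambda>\<epsilon>. K / \<epsilon>\<^sup>2)"
    using mle_guarantee_if_many_repetitions[OF \<delta>(1)] unfolding K_def[symmetric]
    by (intro asymp_le_min_repetitionsI K)
  moreover from asymp_le_scale[OF this N_E] K
  have "asymp_le (min_samples N_E p \<Theta> \<delta>) (\<lambda>\<epsilon>. real N_E * (K / \<epsilon>\<^sup>2))"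
    by (simp add: min_samples_def[abs_def])
  ultimately show ?thesis
    by (simp add: K_def mult.assoc)
qed

end
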